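(* Let $n\in\mathbb{N}_0$ with $n\ge 2$. Then the median of the Sierpiński triangle graph $\widehat{S}^n_3$ is $$M(\widehat{S}^n_3)=\{0,1,2,00,11,22\},$$ so that $|M(\widehat{S}^n_3)|=6$. Moreover, the median vertices of $\widehat{S}^n_3$ are exactly the vertices formed by contracting those non-clique edges of the Sierpiński graph $S^{n+1}_3$ both of whose end vertices belong to the median $M(S^{n+1}_3)$ of $S^{n+1}_3$.
   Context: For a finite connected simple graph $G$ with distance $d$, the median $M(G)$ is the set of vertices $v$ minimizing the total distance $\sum_{u\in V(G)}d(v,u)$. Let $T=\{0,1,2\}$. For $N\in\mathbb{N}_0$ the Sierpiński graph $S^N=S^N_3$ has vertex set $T^N$ (words $s_N\ldots s_1$) and edge set $\{\{\underline{s}ij^{d-1},\underline{s}ji^{d-1}\} : \underline{s}\in T^{N-d},\ i,j\in T,\ i\neq j,\ 1\le d\le N\}=E_0^N\cup E_1^N$ (disjoint union), where $E_0^N$ consists of the edges with $d=1$ (clique edges) and $E_1^N$ of those with $d>1$ (non-clique edges). The extreme vertices are $i^N$, $i\in T$. The Sierpiński triangle graph $\widehat{S}^n=\widehat{S}^n_3$ ($n\in\mathbb{N}_0$) is obtained from $S^{n+1}$ by contracting all edges in $E_1^{n+1}$. Its vertices are labelled as follows. The edge $\{\underline{s}ij^{d-1},\underline{s}ji^{d-1}\}\in E_1^{n+1}$ (with $1<d\le n+1$, $\underline{s}\in T^{n+1-d}$, $i\ne j$) is contracted to the vertex labelled $\underline{s}k$ with $k=3-i-j$; the extreme vertex $i^{n+1}$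 of $S^{n+1}$ becomes the primitive vertex $\widehat{i}$. Thus $V(\widehat{S}^n)=\{\widehat{0},\widehat{1},\widehat{2}\}\cup\bigcup_{\ell=1}^{n}T^{\ell}$. Two distinct vertices of $\widehat{S}^n$ are adjacent iff some vertices of $S^{n+1}$ contracted to them are joined by an edge of $E_0^{n+1}$. *)

theory Defs
  imports Main
begin

text \<open>A simple graph is given by a finite vertex set V and a set E of two-element subsets of V.
  The distance is the least length of a walk; it is only meaningful for vertices joined by some
  walk, hence for all pairs of vertices of a connected graph.\<close>

definition adj_rel :: "'a set set \<Rightarrow> 'a rel" where
  "adj_rel E = {(u, v). {u, v} \<in> E}"

definition gdist :: "'a set set \<Rightarrow> 'a \<Rightarrow> 'a \<Rightarrow> nat" where
  "gdist E u v = (LEAST k. (u, v) \<in> adj_rel E ^^ k)"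

definition total_dist :: "'a set \<Rightarrow> 'a set set \<Rightarrow> 'a \<Rightarrow> nat" where
  "total_dist V E v = (\<Sum>u\<in>V. gdist E v u)"

definition median :: "'a set \<Rightarrow> 'a set set \<Rightarrow> 'a set" where
  "median V E = {v \<in> V. \<forall>w\<in>V. total_dist V E v \<le> total_dist V E w}"

text \<open>The word written \<open>s\<^sub>N \<dots> s\<^sub>1\<close> is the list with head \<open>s\<^sub>N\<close> and last element \<open>s\<^sub>1\<close>.\<close>

definition T :: "nat set" where
  "T = {0, 1, 2}"

definition words :: "nat \<Rightarrow> nat list set" where
  "words N = {w. set w \<subseteq> T \<and> length w = N}"

definition S_edge :: "nat list \<Rightarrow> nat \<Rightarrow> nat \<Rightarrow> nat \<Rightarrow> nat list set" where
  "S_edge s i j d = {s @ [i] @ replicate (d - 1) j, s @ [j] @ replicate (d - 1) i}"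

definition S_verts :: "nat \<Rightarrow> nat list set" where
  "S_verts N = words N"

definition S_edges :: "nat \<Rightarrow> nat list set set" where
  "S_edges N = {S_edge s i j d | s i j d.
     s \<in> words (N - d) \<and> i \<in> T \<and> j \<in> T \<and> i \<noteq> j \<and> 1 \<le> d \<and> d \<le> N}"

definition clique_edges :: "nat \<Rightarrow> nat list set set" where
  "clique_edges N = {S_edge s i j d | s i j d.
     s \<in> words (N - d) \<and> i \<in> T \<and> j \<in> T \<and> i \<noteq> j \<and> 1 \<le> d \<and> d \<le> N \<and> d = 1}"

definition nonclique_edges :: "nat \<Rightarrow> nat list set set" where
  "nonclique_edges N = {S_edge s i j d | s i j d.
     s \<in> words (N - d) \<and> i \<in> T \<and> j \<in> T \<and> i \<noteq> j \<and> 1 < d \<and> d \<le> N}"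

datatype tvertex = Prim nat | Word "nat list"

definition ST_verts :: "nat \<Rightarrow> tvertex set" where
  "ST_verts n = Prim ` T \<union> (\<Union>l\<in>{1..n}. Word ` words l)"

text \<open>The argument n refers to the triangle graph, so the edge e lives in the Sierpinski graph with
  exponent \<open>n + 1\<close>. The subtraction \<open>3 - i - j\<close> does not truncate, since i and j are distinct
  elements of T; it yields the third element. The label is determined by e, because s is the longest
  common prefix of its two end vertices.\<close>

definition edge_contracts_to :: "nat \<Rightarrow> nat list set \<Rightarrow> tvertex \<Rightarrow> bool" where
  "edge_contracts_to n e x \<longleftrightarrow> (\<exists>s i j d.
     s \<in> words (n + 1 - d) \<and> i \<in> T \<and> j \<in> T \<and> i \<noteq> j \<and> 1 < d \<and> d \<le> n + 1 \<and>
     e = S_edge s i j d \<and> x = Word (s @ [3 - i - j]))"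

definition vert_contracts_to :: "nat \<Rightarrow> nat list \<Rightarrow> tvertex \<Rightarrow> bool" where
  "vert_contracts_to n v x \<longleftrightarrow>
     (\<exists>i\<in>T. v = replicate (n + 1) i \<and> x = Prim i) \<or>
     (\<exists>e\<in>nonclique_edges (n + 1). v \<in> e \<and> edge_contracts_to n e x)"

definition ST_edges :: "nat \<Rightarrow> tvertex set set" where
  "ST_edges n = {{x, y} | x y. x \<in> ST_verts n \<and> y \<in> ST_verts n \<and> x \<noteq> y \<and>
     (\<exists>u v. vert_contracts_to n u x \<and> vert_contracts_to n v y \<and> {u, v} \<in> clique_edges (n + 1))}"

end

(* Give every clique edge of S^N length 1 and every non-clique edge length c. For c = 1 this is the
   Sierpinski graph; for c = 0 the words at distance 0 are those that are contracted to the same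
   vertex of the triangle graph. A word iv is reached from ju (with j, i different) through the edge
   between the two subgraphs or through the third subgraph. Summing over v gives a recursion for the
   total distance of ju in terms of that of u and of the distances from u to the corners. From it we
   get, for every c, the same set of words of minimal total distance: i j h^(N-2) with j and h
   different from i. Each non-primitive vertex of the triangle graph stands for exactly two words,
   and the distances of a vertex to the three primitive vertices have a constant sum, so the median
   of the triangle graph is the set of contractions of these words. *)
theory Submission
  imports Defs
begin

subsection \<open>Words over three digits\<close>

text \<open>The obstacle is the minimum in the distance: whether the way through the third subgraph
  pays off depends on both end vertices. Writing min x y as x minus the positive part of x - y and
  summing over the target words moves all of this into one function \<open>gain\<close> of an
  integer, evaluated at a difference of two corner distances of the start word. As a sum of positive
  parts it is convex, piecewise linear, with slopes between 0 and 3^m, and these facts hold for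
  every c. Words whose first two digits differ are handled without induction. After one more digit
  is split off, the remaining word t enters only through its three corner distances and the estimate
  that \<open>rel_total t\<close> is at least -3^m times any of them. Induction on the length serves
  only words that start with a repeated digit. The estimates are tight at the minimizers. That there
  are no other minimizers comes from a factor 3^m - 1, in place of the obvious 3^m, in the bound for
  \<open>gain m 0\<close>.\<close>

lemma third_digit:
  assumes "i \<in> T" "j \<in> T" "i \<noteq> j"
  shows "3 - i - j \<in> T" "3 - i - j \<noteq> i" "3 - i - j \<noteq> j" "T = {i, j, 3 - i - j}"
    "3 - j - i = 3 - i - j"
  using assms by (auto simp: T_def)

lemma third_digit_unique:
  assumes "i \<in> T" "j \<in> T" "k \<in> T" "i \<noteq> j" "i \<noteq> k" "j \<noteq> k"
  shows "3 - i - j = k" "T = {i, j, k}"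
  using assms by (auto simp: T_def)

lemma obtain_digits:
  assumes "i \<in> T"
  obtains j k where "j \<in> T" "k \<in> T" "i \<noteq> j" "i \<noteq> k" "j \<noteq> k"
proof -
  from assms have "i = 0 \<or> i = 1 \<or> i = 2"
    by (auto simp: T_def)
  then show thesis
    using that[of 1 2] that[of 0 2] that[of 0 1] by (auto simp: T_def)
qed

lemma finite_T [simp]: "finite T"
  by (simp add: T_def)

lemma finite_words [simp]: "finite (words N)"
  unfolding words_def using finite_lists_length_eq[OF finite_T] by simp

lemma words_0 [simp]: "words 0 = {[]}"
  by (auto simp: words_def)

lemma Cons_words [simp]: "i # s \<in> words (Suc N) \<longleftrightarrow> i \<in> T \<and> s \<in> words N"
  by (auto simp: words_def)

lemma replicate_words [simp]: "j \<in> T \<Longrightarrow> replicate m j \<in> words m"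
  by (auto simp: words_def)

lemma length_words: "s \<in> words m \<Longrightarrow> length s = m"
  by (simp add: words_def)

lemma words_Suc_cases:
  assumes "u \<in> words (Suc N)"
  obtains i s where "u = i # s" "i \<in> T" "s \<in> words N"
  using assms by (cases u) (auto simp: words_def)

lemma words_Suc: "words (Suc N) = (\<Union>i\<in>T. (#) i ` words N)"
  by (fastforce elim: words_Suc_cases)

lemma sum_words_Suc: "(\<Sum>t\<in>words (Suc N). F t) = (\<Sum>i\<in>T. \<Sum>t\<in>words N. F (i # t))"
proof -
  have "(\<Sum>t\<in>words (Suc N). F t) = (\<Sum>i\<in>T. \<Sum>t\<in>(#) i ` words N. F t)"
    unfolding words_Suc by (rule sum.UNION_disjoint) auto
  also have "\<dots> = (\<Sum>i\<in>T. \<Sum>t\<in>words N. F (i # t))"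
    by (simp add: sum.reindex)
  finally show ?thesis .
qed

lemma card_words: "card (words N) = 3 ^ N"
proof -
  have "card T = 3"
    by (simp add: T_def)
  then show ?thesis
    unfolding words_def using card_lists_length_eq[OF finite_T, of N] by simp
qed

lemma sum_T:
  assumes "i \<in> T" "j \<in> T" "k \<in> T" "i \<noteq> j" "i \<noteq> k" "j \<noteq> k"
  shows "sum F T = F i + (F j + F k)"
  using assms(4-6) unfolding third_digit_unique(2)[OF assms] by simp

subsection \<open>Distances with free non-clique edges\<close>

text \<open>An edge that differs in the last d digits costs 1 if d = 1 and c otherwise. For c = 1 the
  resulting distance is the one of the Sierpinski graph, for c = 0 the one of its contraction.\<close>

context
  fixes c :: nat
begin

definition link :: "nat \<Rightarrow> nat" where
  "link m = (if m = 0 then 1 else c)"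

text \<open>The distance between two extreme vertices: two copies and the edge that joins them. It
  is 2^m - 1 for c = 1, and 2^(m-1) for c = 0 and m > 0.\<close>

primrec diam :: "nat \<Rightarrow> nat" where
  "diam 0 = 0"
| "diam (Suc m) = 2 * diam m + link m"

text \<open>What a leading digit other than j adds to the distance to corner j: one joining edge and
  the traversal of a whole copy. A corner is always reached most cheaply by the direct edge, so
  \<open>corner_dist\<close> contains no minimum.\<close>

definition weight :: "nat \<Rightarrow> nat" where
  "weight m = diam m + link m"

primrec corner_dist :: "nat \<Rightarrow> nat list \<Rightarrow> nat" where
  "corner_dist j [] = 0"
| "corner_dist j (i # s) = (if i = j then 0 else weight (length s)) + corner_dist j s"

text \<open>The two arguments of \<open>min\<close> are the way over the joining edge and the way
  across the whole third copy. Only words of equal length matter; the last equation covers the empty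
  word and otherwise serves as a default.\<close>

fun wdist :: "nat list \<Rightarrow> nat list \<Rightarrow> nat" where
  "wdist (i # s) (j # t) = (if i = j then wdist s t else
     min (corner_dist j s + link (length s) + corner_dist i t)
       (corner_dist (3 - i - j) s + 2 * link (length s) + diam (length s) + corner_dist (3 - i - j) t))"
| "wdist _ _ = 0"

text \<open>The index m counts the digits behind the first one in which the end vertices differ.\<close>

inductive sedge :: "nat \<Rightarrow> nat list \<Rightarrow> nat list \<Rightarrow> bool" where
  top: "i \<in> T \<Longrightarrow> j \<in> T \<Longrightarrow> i \<noteq> j \<Longrightarrow> sedge m (i # replicate m j) (j # replicate m i)"
| Cons: "sedge m u v \<Longrightarrow> h \<in> T \<Longrightarrow> sedge m (h # u) (h # v)"

inductive walk :: "nat \<Rightarrow> nat list \<Rightarrow> nat list \<Rightarrow> bool" where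
  stay: "walk 0 u u"
| step: "sedge m u v \<Longrightarrow> walk k v x \<Longrightarrow> walk (link m + k) u x"

lemma corner_dist_replicate:
  "corner_dist j (replicate m i) = (if i = j then 0 else diam m)"
  by (induction m) (auto simp: weight_def)

lemma corner_dist_le: "corner_dist j s \<le> diam (length s)"
  by (induction s) (auto simp: weight_def)

lemma corner_dist_sum:
  assumes "i \<in> T" "j \<in> T" "k \<in> T" "i \<noteq> j" "i \<noteq> k" "j \<noteq> k" "s \<in> words m"
  shows "corner_dist i s + corner_dist j s + corner_dist k s = 2 * diam m"
  using assms(7)
proof (induction m arbitrary: s)
  case (Suc m)
  then obtain x t where "s = x # t" "x \<in> {i, j, k}" "t \<in> words m"
    using third_digit_unique(2)[OF assms(1-6)] by (auto elim: words_Suc_cases)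
  then show ?case
    using Suc.IH[of t] assms(4-6) by (auto simp: weight_def length_words)
qed (auto simp: words_def)

lemma diam_pos: "m > 0 \<Longrightarrow> diam m > 0"
  by (induction m) (auto simp: link_def)

lemma weight_pos: "weight m > 0"
  using diam_pos[of m] by (cases m) (auto simp: weight_def link_def)

lemma corner_dist_eq_0:
  assumes "s \<in> words m"
  shows "corner_dist j s = 0 \<longleftrightarrow> s = replicate m j"
  using assms
proof (induction m arbitrary: s)
  case (Suc m)
  then obtain x t where "s = x # t" "t \<in> words m"
    by (auto elim: words_Suc_cases)
  then show ?case
    using Suc.IH[of t] weight_pos[of "length t"] by auto
qed (auto simp: words_def)

lemma wdist_self [simp]: "wdist u u = 0"
  by (induction u) auto

lemma wdist_sym: "length u = length v \<Longrightarrow> wdist u v = wdist v u"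
  by (induction u v rule: list_induct2) (auto simp: ac_simps min.commute)

lemma wdist_replicate:
  assumes "s \<in> words m" "j \<in> T"
  shows "wdist s (replicate m j) = corner_dist j s"
  using assms(1)
proof (induction m arbitrary: s)
  case (Suc m)
  then obtain x t where s: "s = x # t" "x \<in> T" "t \<in> words m"
    by (auto elim: words_Suc_cases)
  show ?case
  proof (cases "x = j")
    case False
    then show ?thesis
      using s corner_dist_le[of j t] third_digit[OF s(2) assms(2) False]
      by (auto simp: corner_dist_replicate weight_def length_words min_def)
  qed (use s Suc.IH[of t] in auto)
qed (auto simp: words_def)

section \<open>\<open>wdist\<close> as the distance of the weighted graph\<close>

lemma sedge_sym: "sedge m u v \<Longrightarrow> sedge m v u"
  by (induction rule: sedge.induct) (auto intro: sedge.intros)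

lemma sedge_length: "sedge m u v \<Longrightarrow> length u = length v"
  by (induction rule: sedge.induct) auto

lemma sedge_words: "sedge m u v \<Longrightarrow> u \<in> words (length u) \<and> v \<in> words (length v)"
  by (induction rule: sedge.induct) (auto simp: words_def)

lemma sedge_corner_dist: "sedge m u v \<Longrightarrow> corner_dist h u \<le> link m + corner_dist h v"
  by (induction rule: sedge.induct) (auto simp: corner_dist_replicate weight_def dest: sedge_length)

text \<open>This Lipschitz property makes \<open>wdist\<close> a lower bound for the cost of walks.
  In the case \<open>top\<close> with h the third digit, the direct way from one end of the edge and
  the detour from the other end enter the copy of h at the same corner, so their lengths differ by
  just the cost of the edge.\<close>

lemma sedge_wdist:
  "sedge m u v \<Longrightarrow> x \<in> words (length u) \<Longrightarrow> wdist u x \<le> link m + wdist v x"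
proof (induction arbitrary: x rule: sedge.induct)
  case (top i j m)
  then obtain h t where x: "x = h # t" "h \<in> T" "t \<in> words m"
    by (auto elim: words_Suc_cases)
  note rep = wdist_replicate[OF x(3)] wdist_sym[of "replicate m _" t] length_words[OF x(3)]
    corner_dist_replicate
  note td = third_digit[OF top(1-3)]
  from td(4) x(2) consider "h = i" | "h = j" | "h = 3 - i - j"
    by auto
  then show ?case
  proof cases
    case 1
    then show ?thesis
      using top x corner_dist_le[of j t] by (auto simp: rep td min_def)
  next
    case 2
    then show ?thesis
      using top x by (auto simp: rep td min_def)
  next
    case 3
    then have h: "h \<noteq> i" "h \<noteq> j" "3 - i - h = j" "3 - j - h = i"
      using top(1-3) by (auto simp: T_def)
    have "wdist (i # replicate m j) x =
        min (diam m + link m + corner_dist i t) (2 * link m + diam m + corner_dist j t)"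
      using h x top(3) by (simp add: rep)
    moreover have "wdist (j # replicate m i) x =
        min (diam m + link m + corner_dist j t) (2 * link m + diam m + corner_dist i t)"
      using h x top(3) by (simp add: rep)
    ultimately show ?thesis
      by (simp add: min_def)
  qed
next
  case (Cons m u v h)
  then obtain h' t where x: "x = h' # t" "t \<in> words (length u)"
    by (auto elim: words_Suc_cases)
  then show ?case
    using Cons.IH[OF x(2)] sedge_length[OF Cons(1)] sedge_corner_dist[OF Cons(1), of h']
      sedge_corner_dist[OF Cons(1), of "3 - h - h'"] by (auto simp: min_def)
qed

lemma walk_trans: "walk k u v \<Longrightarrow> walk l v x \<Longrightarrow> walk (k + l) u x"
  by (induction rule: walk.induct) (auto intro: walk.step simp: add.assoc)

lemma walk_edge: "sedge m u v \<Longrightarrow> walk (link m) u v"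
  using walk.step[OF _ walk.stay] by simp

lemma walk_sym: "walk k u v \<Longrightarrow> walk k v u"
proof (induction rule: walk.induct)
  case (step m u v k x)
  then show ?case
    using walk_trans[OF step.IH walk_edge[OF sedge_sym[OF step(1)]]] by (simp add: add.commute)
qed (rule walk.stay)

lemma walk_Cons: "walk k u v \<Longrightarrow> h \<in> T \<Longrightarrow> walk k (h # u) (h # v)"
  by (induction rule: walk.induct) (auto intro: walk.intros sedge.Cons)

lemma walk_corner:
  assumes "s \<in> words m" "j \<in> T"
  shows "walk (corner_dist j s) s (replicate m j)"
  using assms
proof (induction m arbitrary: s j)
  case (Suc m)
  then obtain x t where s: "s = x # t" "x \<in> T" "t \<in> words m"
    by (auto elim: words_Suc_cases)
  have 1: "walk (corner_dist j t) s (x # replicate m j)"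
    unfolding s(1) by (rule walk_Cons[OF Suc.IH[OF s(3) Suc.prems(2)] s(2)])
  show ?case
  proof (cases "x = j")
    case False
    have "walk (link m) (x # replicate m j) (j # replicate m x)"
      by (intro walk_edge sedge.top s False Suc.prems)
    moreover have "walk (diam m) (j # replicate m x) (j # replicate m j)"
      using walk_Cons[OF Suc.IH[of "replicate m x" j]] False Suc.prems s(2)
      by (simp add: corner_dist_replicate)
    ultimately have "walk (corner_dist j t + (link m + diam m)) s (replicate (Suc m) j)"
      using 1 walk_trans by simp
    then show ?thesis
      using s False by (simp add: weight_def length_words ac_simps)
  qed (use 1 s in auto)
qed (auto intro: walk.stay)

lemma walk_wdist:
  assumes "s \<in> words m" "t \<in> words m"
  shows "walk (wdist s t) s t"
  using assms
proof (induction m arbitrary: s t)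
  case (Suc m)
  obtain i s' where s: "s = i # s'" "i \<in> T" "s' \<in> words m"
    using Suc.prems by (auto elim: words_Suc_cases)
  obtain j t' where t: "t = j # t'" "j \<in> T" "t' \<in> words m"
    using Suc.prems by (auto elim: words_Suc_cases)
  have out: "walk (corner_dist h s') (i # s') (i # replicate m h)" if "h \<in> T" for h
    by (intro walk_Cons walk_corner s that)
  have in': "walk (corner_dist h t') (j # replicate m h) (j # t')" if "h \<in> T" for h
    by (intro walk_Cons[OF walk_sym] walk_corner t that)
  show ?case
  proof (cases "i = j")
    case True
    then show ?thesis
      using s t Suc.IH[OF s(3) t(3)] by (auto intro: walk_Cons)
  next
    case False
    define k where "k = 3 - i - j"
    note td = third_digit[OF s(2) t(2) False, folded k_def]
    have direct: "walk (corner_dist j s' + (link m + corner_dist i t')) (i # s') (j # t')"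
      by (intro walk_trans[OF out] walk_trans[OF walk_edge[OF sedge.top] in'] s t False)
    have "walk (corner_dist j (replicate m i)) (replicate m i) (replicate m j)"
      by (intro walk_corner replicate_words s t)
    then have "walk (diam m) (k # replicate m i) (k # replicate m j)"
      using walk_Cons[OF _ td(1)] False by (simp add: corner_dist_replicate)
    then have via: "walk (corner_dist k s' + (link m + (diam m + (link m + corner_dist k t'))))
        (i # s') (j # t')"
      by (intro walk_trans[OF out] walk_trans[OF walk_edge[OF sedge.top]]
          walk_trans[OF _ walk_trans[OF walk_edge[OF sedge.top] in']])
        (use s t td in auto)
    have "wdist s t = min (corner_dist j s' + (link m + corner_dist i t'))
        (corner_dist k s' + (link m + (diam m + (link m + corner_dist k t'))))"
      using s t False by (simp add: length_words k_def ac_simps mult_2)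
    then show ?thesis
      using direct via s t by (auto simp: min_def)
  qed
qed (auto intro: walk.stay)

subsection \<open>Total distances\<close>

text \<open>The value gain m z is the sum of \<open>max 0 (z + corner_dist i t - corner_dist k t)\<close>
  over all words t of length m, for any two distinct digits i and k.\<close>

primrec gain :: "nat \<Rightarrow> int \<Rightarrow> int" where
  "gain 0 z = max 0 z"
| "gain (Suc m) z = gain m (z + int (weight m)) + gain m z + gain m (z - int (weight m))"

text \<open>What is saved in total by the detours through the third subgraph, if the start vertex is
  closer by y to the corner of the third subgraph.\<close>

definition detour_gain :: "nat \<Rightarrow> int \<Rightarrow> int" where
  "detour_gain m y = gain m (y - int (weight m))"

text \<open>The total distance of a vertex relative to that of the extreme vertices.\<close>

primrec rel_total :: "nat list \<Rightarrow> int" where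
  "rel_total [] = 0"
| "rel_total (i # s) = rel_total s - 3 ^ length s * int (corner_dist i s) -
     detour_gain (length s) \<bar>int (corner_dist ((i + 1) mod 3) s) - int (corner_dist ((i + 2) mod 3) s)\<bar>"

text \<open>A leading digit i of t adds the weight to the distance to k only, a leading k to the
  distance to i only, the third digit to both. So z is shifted by -weight, +weight or 0, which are
  the three terms of the recursion of \<open>gain\<close>.\<close>

lemma sum_max_corner_dist:
  assumes "i \<in> T" "k \<in> T" "i \<noteq> k"
  shows "(\<Sum>t\<in>words m. max 0 (z + int (corner_dist i t) - int (corner_dist k t))) = gain m z"
proof (induction m arbitrary: z)
  case (Suc m)
  define j where "j = 3 - i - k"
  note td = third_digit[OF assms, folded j_def]
  have [simp]: "t \<in> words m \<Longrightarrow> length t = m" for t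
    by (rule length_words)
  have "(\<Sum>t\<in>words (Suc m). max 0 (z + int (corner_dist i t) - int (corner_dist k t)))
      = (\<Sum>t\<in>words m. max 0 (z - int (weight m) + int (corner_dist i t) - int (corner_dist k t))) +
       ((\<Sum>t\<in>words m. max 0 (z + int (weight m) + int (corner_dist i t) - int (corner_dist k t))) +
        (\<Sum>t\<in>words m. max 0 (z + int (corner_dist i t) - int (corner_dist k t))))"
    unfolding sum_words_Suc sum_T[OF assms(1,2) td(1) assms(3) td(2,3)[symmetric]]
    using assms(3) td(2,3) by (intro arg_cong2[of _ _ _ _ "(+)"] sum.cong) (auto simp: algebra_simps)
  then show ?case
    by (simp add: Suc.IH)
qed simp

lemma sum_corner_dist: "\<exists>S. \<forall>i\<in>T. (\<Sum>t\<in>words m. int (corner_dist i t)) = S"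
proof (induction m)
  case (Suc m)
  then obtain S where S: "\<And>i. i \<in> T \<Longrightarrow> (\<Sum>t\<in>words m. int (corner_dist i t)) = S"
    by blast
  have [simp]: "t \<in> words m \<Longrightarrow> length t = m" for t
    by (rule length_words)
  have "(\<Sum>t\<in>words (Suc m). int (corner_dist i t)) = 3 * S + 2 * 3 ^ m * int (weight m)" if "i \<in> T" for i
  proof -
    from that obtain j k where jk: "j \<in> T" "k \<in> T" "i \<noteq> j" "i \<noteq> k" "j \<noteq> k"
      by (rule obtain_digits)
    show ?thesis
      unfolding sum_words_Suc sum_T[OF that jk]
      using jk S[OF that] by (simp add: sum.distrib card_words)
  qed
  then show ?case
    by blast
qed auto

lemma rel_total_Cons:
  assumes "i \<in> T" "j \<in> T" "k \<in> T" "i \<noteq> j" "i \<noteq> k" "j \<noteq> k" "length s = m"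
  shows "rel_total (i # s) = rel_total s - 3 ^ m * int (corner_dist i s) -
     detour_gain m \<bar>int (corner_dist j s) - int (corner_dist k s)\<bar>"
proof -
  have "(i + 1) mod 3 = j \<and> (i + 2) mod 3 = k \<or> (i + 1) mod 3 = k \<and> (i + 2) mod 3 = j"
    using assms(1-6) by (auto simp: T_def)
  then show ?thesis
    using assms(7) by (auto simp: abs_minus_commute)
qed

declare rel_total.simps(2) [simp del]

section \<open>Linear bounds, convexity and symmetry of \<open>gain\<close> and
  \<open>detour_gain\<close>\<close>

lemma gain_eq_0: "z \<le> - int (diam m) \<Longrightarrow> gain m z = 0"
  by (induction m arbitrary: z) (auto simp: weight_def)

text \<open>Two corner distances differ by at most the diameter, so beyond it all summands are
  nonnegative before truncation, and their differences cancel by symmetry.\<close>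

lemma gain_eq: "z \<ge> int (diam m) \<Longrightarrow> gain m z = 3 ^ m * z"
  by (induction m arbitrary: z) (auto simp: weight_def algebra_simps)

lemma gain_reflect: "gain m z - gain m (- z) = 3 ^ m * z"
proof (induction m arbitrary: z)
  case (Suc m)
  show ?case
    using Suc.IH[of z] Suc.IH[of "z + int (weight m)"] Suc.IH[of "z - int (weight m)"]
    by (simp add: algebra_simps)
qed auto

lemma gain_mono: "z \<le> z' \<Longrightarrow> gain m z \<le> gain m z'"
  by (induction m arbitrary: z z') (auto intro!: add_mono)

lemma gain_slope: "z \<le> z' \<Longrightarrow> gain m z' \<le> gain m z + 3 ^ m * (z' - z)"
proof (induction m arbitrary: z z')
  case (Suc m)
  show ?case
    using Suc.IH[of z z'] Suc.IH[of "z + int (weight m)" "z' + int (weight m)"]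
      Suc.IH[of "z - int (weight m)" "z' - int (weight m)"] Suc.prems
    by (simp add: algebra_simps)
qed auto

lemma gain_convex:
  assumes "x \<le> y" "y \<le> z"
  shows "(z - x) * gain m y \<le> (z - y) * gain m x + (y - x) * gain m z"
  using assms
proof (induction m arbitrary: x y z)
  case 0
  have "(z - y) * x \<le> (z - y) * max 0 x" "(y - x) * z \<le> (y - x) * max 0 z"
    using 0 by (intro mult_left_mono; simp)+
  moreover have "0 \<le> (z - y) * max 0 x" "0 \<le> (y - x) * max 0 z"
    using 0 by (intro mult_nonneg_nonneg; simp)+
  moreover have "(z - x) * y = (z - y) * x + (y - x) * z"
    by (simp add: algebra_simps)
  moreover have "max 0 y = y \<or> max 0 y = 0"
    by auto
  ultimately show ?case
    by (elim disjE) (simp_all only: gain.simps mult_zero_right)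
next
  case (Suc m)
  show ?case
    using Suc.IH[of x y z] Suc.IH[of "x + int (weight m)" "y + int (weight m)" "z + int (weight m)"]
      Suc.IH[of "x - int (weight m)" "y - int (weight m)" "z - int (weight m)"] Suc.prems
    by (simp add: distrib_left)
qed

text \<open>Convexity on the interval from -diam to diam, with end values 0 and 3^m * diam.\<close>

lemma gain_chord:
  assumes "\<bar>z\<bar> \<le> int (diam m)"
  shows "2 * gain m z \<le> 3 ^ m * (z + int (diam m))"
proof (cases "int (diam m) = 0")
  case False
  have "2 * int (diam m) * gain m z \<le> (z + int (diam m)) * (3 ^ m * int (diam m))"
    using gain_convex[of "- int (diam m)" z "int (diam m)" m] assms
    by (simp add: gain_eq gain_eq_0)
  then have "int (diam m) * (2 * gain m z) \<le> int (diam m) * (3 ^ m * (z + int (diam m)))"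
    by (simp add: algebra_simps)
  then show ?thesis
    using False by (simp only: mult_le_cancel_left)
qed (use assms in \<open>auto simp: gain_eq\<close>)

text \<open>\<open>2 * gain m 0\<close> is the sum of the absolute differences of two corner
  distances over all 3^m words, each at most the diameter. The extreme vertex of the third digit has
  difference 0, which explains the - 1.\<close>

lemma gain_0: "2 * gain m 0 \<le> (3 ^ m - 1) * int (diam m)"
proof (induction m)
  case (Suc m)
  have "gain (Suc m) 0 = 3 ^ m * int (weight m) + gain m 0"
    by (simp add: gain_eq gain_eq_0 weight_def)
  moreover have "0 \<le> (3 * (3::int) ^ m - 1) * int (diam m) + (3 ^ m - 1) * int (link m)"
    by (intro add_nonneg_nonneg mult_nonneg_nonneg) auto
  ultimately show ?case
    using Suc.IH by (simp add: weight_def algebra_simps del: gain.simps)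
qed simp

lemma gain_half_chord:
  assumes "- int (diam m) \<le> z" "z \<le> 0"
  shows "2 * gain m z \<le> (3 ^ m - 1) * (z + int (diam m))"
proof (cases "int (diam m) = 0")
  case False
  have "int (diam m) * gain m z \<le> (z + int (diam m)) * gain m 0"
    using gain_convex[of "- int (diam m)" z 0 m] assms by (simp add: gain_eq_0)
  moreover have "(z + int (diam m)) * (2 * gain m 0) \<le> (z + int (diam m)) * ((3 ^ m - 1) * int (diam m))"
    using assms by (intro mult_left_mono gain_0) auto
  ultimately have "int (diam m) * (2 * gain m z) \<le> int (diam m) * ((3 ^ m - 1) * (z + int (diam m)))"
    by (simp add: algebra_simps)
  then show ?thesis
    using False by (simp only: mult_le_cancel_left)
qed (use assms in \<open>auto simp: gain_eq\<close>)

lemma detour_gain_eq_0: "y \<le> int (link m) \<Longrightarrow> detour_gain m y = 0"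
  by (simp add: detour_gain_def gain_eq_0 weight_def)

lemma detour_gain_mono: "y \<le> y' \<Longrightarrow> detour_gain m y \<le> detour_gain m y'"
  by (simp add: detour_gain_def gain_mono)

lemma detour_gain_slope: "y \<le> y' \<Longrightarrow> detour_gain m y' \<le> detour_gain m y + 3 ^ m * (y' - y)"
  using gain_slope[of "y - int (weight m)" "y' - int (weight m)" m] by (simp add: detour_gain_def)

lemma detour_gain_le: "y \<ge> 0 \<Longrightarrow> detour_gain m y \<le> 3 ^ m * y"
  using detour_gain_slope[of 0 y m] by (simp add: detour_gain_eq_0)

lemma detour_gain_half:
  assumes "y \<le> int (weight m)" "int (link m) \<le> y"
  shows "2 * detour_gain m y \<le> (3 ^ m - 1) * (y - int (link m))"
  using gain_half_chord[of m "y - int (weight m)"] assms by (simp add: detour_gain_def weight_def)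

text \<open>A convex function that vanishes at 0 is superadditive on nonnegative arguments.\<close>

lemma detour_gain_superadditive:
  assumes "x \<ge> 0" "y \<ge> 0"
  shows "detour_gain m x + detour_gain m y \<le> detour_gain m (x + y)"
proof (cases "x + y = 0")
  case False
  have *: "(x + y) * detour_gain m z \<le> z * detour_gain m (x + y)" if "0 \<le> z" "z \<le> x + y" for z
    using gain_convex[of "- int (weight m)" "z - int (weight m)" "x + y - int (weight m)" m] that
      detour_gain_eq_0[of 0 m] by (simp add: detour_gain_def)
  have "(x + y) * (detour_gain m x + detour_gain m y) \<le> (x + y) * detour_gain m (x + y)"
    using *[of x] *[of y] assms by (simp add: distrib_left distrib_right)
  then show ?thesis
    using False assms by (simp only: mult_le_cancel_left)
next
  case True
  then have "x = 0" "y = 0"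
    using assms by auto
  then show ?thesis
    by (simp add: detour_gain_eq_0)
qed

text \<open>Each of the two other copies contributes the length of the direct ways minus the savings
  by detours. The constant sum of the corner distances then replaces those to j and k by the one to
  i.\<close>

lemma sum_wdist:
  "\<exists>K. \<forall>s\<in>words m. (\<Sum>t\<in>words m. int (wdist s t)) = rel_total s + K"
proof (induction m)
  case (Suc m)
  then obtain K where K: "\<And>s. s \<in> words m \<Longrightarrow> (\<Sum>t\<in>words m. int (wdist s t)) = rel_total s + K"
    by blast
  obtain S where S: "\<And>i. i \<in> T \<Longrightarrow> (\<Sum>t\<in>words m. int (corner_dist i t)) = S"
    using sum_corner_dist by blast
  have "(\<Sum>t\<in>words (Suc m). int (wdist u t)) = rel_total u + (K + 2 * S + 2 * 3 ^ m * int (weight m))"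
    if "u \<in> words (Suc m)" for u
  proof -
    from that obtain i s where u: "u = i # s" "i \<in> T" "s \<in> words m"
      by (rule words_Suc_cases)
    from u(2) obtain j k where jk: "j \<in> T" "k \<in> T" "i \<noteq> j" "i \<noteq> k" "j \<noteq> k"
      by (rule obtain_digits)
    have other: "(\<Sum>t\<in>words m. int (wdist u (a # t))) =
        3 ^ m * (int (corner_dist a s) + int (link m)) + S -
        detour_gain m (int (corner_dist a s) - int (corner_dist b s))"
      if ab: "a \<in> T" "b \<in> T" "i \<noteq> a" "i \<noteq> b" "a \<noteq> b" for a b
    proof -
      define A where "A = int (corner_dist a s) + int (link m)"
      define z where "z = int (corner_dist a s) - int (corner_dist b s) - int (weight m)"
      have b: "3 - i - a = b"
        by (rule third_digit_unique(1)) (use u ab in auto)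
      have "(\<Sum>t\<in>words m. int (wdist u (a # t))) = (\<Sum>t\<in>words m. A + int (corner_dist i t) -
          max 0 (z + int (corner_dist i t) - int (corner_dist b t)))"
      proof (rule sum.cong)
        fix t assume "t \<in> words m"
        \<comment> \<open>With x the direct way and y the detour, the truncated difference is a
          summand of \<open>gain\<close>.\<close>
        have "int (min x y) = int x - max 0 (int x - int y)" for x y :: nat
          by (auto simp: min_def max_def)
        moreover have "wdist u (a # t) = min (corner_dist a s + link m + corner_dist i t)
            (corner_dist b s + 2 * link m + diam m + corner_dist b t)"
          using u ab(3) b by (simp add: length_words)
        ultimately show "int (wdist u (a # t)) = A + int (corner_dist i t) -
            max 0 (z + int (corner_dist i t) - int (corner_dist b t))"
          by (simp add: A_def z_def weight_def algebra_simps)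
      qed simp
      also have "\<dots> = 3 ^ m * A + S - gain m z"
        by (simp add: sum.distrib sum_subtractf card_words S u(2) sum_max_corner_dist[OF u(2) ab(2,4)])
      finally show ?thesis
        by (simp add: A_def z_def detour_gain_def)
    qed
    \<comment> \<open>Detours pay for at most one of the two other copies, since
      \<open>detour_gain\<close> vanishes at arguments that are not positive.\<close>
    have abs: "detour_gain m y + detour_gain m (- y) = detour_gain m \<bar>y\<bar>" for y
      by (cases "y \<ge> 0") (auto simp: detour_gain_eq_0)
    have sum: "int (corner_dist i s) + int (corner_dist j s) + int (corner_dist k s) = 2 * int (diam m)"
      using corner_dist_sum[OF u(2) jk u(3)] by presburger
    have "(\<Sum>t\<in>words (Suc m). int (wdist u t)) = rel_total s + K +
        (3 ^ m * (int (corner_dist j s) + int (link m)) + S -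
          detour_gain m (int (corner_dist j s) - int (corner_dist k s)) +
        (3 ^ m * (int (corner_dist k s) + int (link m)) + S -
          detour_gain m (int (corner_dist k s) - int (corner_dist j s))))"
      unfolding sum_words_Suc sum_T[OF u(2) jk] other[OF jk] other[OF jk(2,1,4,3) jk(5)[symmetric]]
      using K[OF u(3)] by (simp add: u(1))
    also have "\<dots> = rel_total s + K +
        3 ^ m * (int (corner_dist j s) + int (corner_dist k s) + 2 * int (link m)) + 2 * S -
        detour_gain m \<bar>int (corner_dist j s) - int (corner_dist k s)\<bar>"
      using abs[of "int (corner_dist j s) - int (corner_dist k s)"] by (simp add: algebra_simps)
    also have "int (corner_dist j s) + int (corner_dist k s) = 2 * int (diam m) - int (corner_dist i s)"
      using sum by simp
    finally show ?thesis
      unfolding u(1) rel_total_Cons[OF u(2) jk length_words[OF u(3)]]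
      by (simp add: weight_def algebra_simps)
  qed
  then show ?case
    by blast
qed simp

subsection \<open>Minimal total distance\<close>

text \<open>The value of \<open>rel_total\<close> at \<open>i # replicate m j\<close> for i
  different from j, hence the minimum for words of length m + 1, not m.\<close>

definition min_total :: "nat \<Rightarrow> int" where
  "min_total m = - (3 ^ m * int (diam m)) - detour_gain m (int (diam m))"

lemma int_corner_dist:
  assumes "i \<in> T" "j \<in> T" "k \<in> T" "i \<noteq> j" "i \<noteq> k" "j \<noteq> k" "s \<in> words m"
  shows "int (corner_dist i s) + int (corner_dist j s) + int (corner_dist k s) = 2 * int (diam m)"
    "int (corner_dist i s) \<le> int (diam m)" "int (corner_dist j s) \<le> int (diam m)" "int (corner_dist k s) \<le> int (diam m)"
  using corner_dist_sum[OF assms] corner_dist_le[of _ s] length_words[OF assms(7)]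
  by (auto simp flip: of_nat_add)

text \<open>The triangle inequality in disguise: moving from s to the extreme vertex of x, where
  \<open>rel_total\<close> is 0, changes each of the 3^m distances by at most
  \<open>corner_dist x s\<close>. The proof uses only the recursion.\<close>

lemma rel_total_ge:
  assumes "s \<in> words m" "x \<in> T"
  shows "rel_total s \<ge> - (3 ^ m * int (corner_dist x s))"
  using assms
proof (induction m arbitrary: s x)
  case (Suc m)
  from Suc.prems(1) obtain i t where s: "s = i # t" "i \<in> T" "t \<in> words m"
    by (rule words_Suc_cases)
  from s(2) obtain j k where jk: "j \<in> T" "k \<in> T" "i \<noteq> j" "i \<noteq> k" "j \<noteq> k"
    by (rule obtain_digits)
  note t = int_corner_dist[OF s(2) jk s(3)]
  let ?a = "int (corner_dist i t)" and ?D = "int (diam m)" and ?Q = "(3::int) ^ m"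
  let ?y = "\<bar>int (corner_dist j t) - int (corner_dist k t)\<bar>"
  note g = rel_total_Cons[OF s(2) jk length_words[OF s(3)], folded s(1)]
  have "detour_gain m ?y \<le> ?Q * ?y"
    by (rule detour_gain_le) simp
  \<comment> \<open>The three corner distances have sum 2 * ?D and none exceeds ?D; hence two of
    them differ by at most the third.\<close>
  moreover have "?Q * ?y \<le> ?Q * ?a"
    using t by (intro mult_left_mono) auto
  moreover have "?Q * ?a \<le> ?Q * ?D"
    using t by (intro mult_left_mono) auto
  moreover have "?Q * ?D \<le> ?Q * int (weight m)"
    by (intro mult_left_mono) (auto simp: weight_def)
  moreover have "rel_total t \<ge> - (?Q * int (corner_dist x t))"
    by (rule Suc.IH[OF s(3) Suc.prems(2)])
  moreover have "0 \<le> ?Q * int (corner_dist x t)"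
    by simp
  moreover have "3 ^ Suc m * int (corner_dist x s) = 3 * (?Q * ?a) \<or>
      3 ^ Suc m * int (corner_dist x s) = 3 * (?Q * int (weight m)) + 3 * (?Q * int (corner_dist x t))"
    using length_words[OF s(3)] by (auto simp: s(1) algebra_simps)
  moreover have "rel_total t \<ge> - (?Q * ?a)"
    by (rule Suc.IH[OF s(3) s(2)])
  ultimately show ?case
    unfolding g by linarith
qed auto

lemma rel_total_replicate:
  assumes "i \<in> T"
  shows "rel_total (replicate m i) = 0"
proof (induction m)
  case (Suc m)
  from assms obtain j k where "j \<in> T" "k \<in> T" "i \<noteq> j" "i \<noteq> k" "j \<noteq> k"
    by (rule obtain_digits)
  from rel_total_Cons[OF assms this, of "replicate m i" m] Suc \<open>i \<noteq> j\<close> \<open>i \<noteq> k\<close> show ?case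
    by (simp add: corner_dist_replicate detour_gain_eq_0)
qed simp

lemma rel_total_Cons_replicate:
  assumes "i \<in> T" "j \<in> T" "i \<noteq> j"
  shows "rel_total (i # replicate m j) = min_total m"
  using rel_total_Cons[OF assms(1,2) third_digit(1)[OF assms] assms(3)
      third_digit(2,3)[OF assms, symmetric], of "replicate m j" m] assms third_digit(3)[OF assms]
  by (simp add: rel_total_replicate corner_dist_replicate min_total_def)

text \<open>The weight doubles from m to m + 1 only for m > 0, because \<open>link 0\<close> is 1
  for every c while all later links are c.\<close>

lemma detour_gain_Suc:
  assumes "m > 0" "y \<le> int (diam m) + int (weight m)"
  shows "detour_gain (Suc m) y = detour_gain m y + detour_gain m (y - int (weight m))"
proof -
  have "gain m (y - int (weight m) - int (weight m) - int (weight m)) = 0"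
    using assms(2) by (intro gain_eq_0) (auto simp: weight_def)
  moreover have "int (weight (Suc m)) = 2 * int (weight m)"
    using assms(1) by (simp add: weight_def link_def)
  ultimately show ?thesis
    by (simp add: detour_gain_def algebra_simps)
qed

lemma detour_gain_Suc_weight:
  assumes "m > 0" "v \<le> int (diam m)"
  shows "detour_gain (Suc m) (int (weight m) + v) = gain m v + detour_gain m v"
  using detour_gain_Suc[OF assms(1), of "int (weight m) + v"] assms(2) by (simp add: detour_gain_def)

lemma min_total_Suc:
  assumes "m > 0"
  shows "min_total (Suc m) = - (3 ^ Suc m * (int (weight m) + int (diam m)))
    - 3 ^ m * int (diam m) - detour_gain m (int (diam m))"
proof -
  have "int (diam (Suc m)) = int (weight m) + int (diam m)"
    by (simp add: weight_def)
  then show ?thesis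
    using detour_gain_Suc_weight[OF assms, of "int (diam m)"] by (simp only: min_total_def) (simp add: gain_eq)
qed

text \<open>Brings everything to level m. The weight exceeds or equals every corner distance of s,
  so the absolute value in the outer recursion step has a known sign and
  \<open>detour_gain_Suc_weight\<close> applies.\<close>

lemma rel_total_Cons_Cons:
  assumes "i \<in> T" "j \<in> T" "k \<in> T" "i \<noteq> j" "i \<noteq> k" "j \<noteq> k" "s \<in> words m" "m > 0"
  shows "rel_total (i # j # s) - min_total (Suc m) =
    rel_total s - 3 ^ m * int (corner_dist j s)
      - detour_gain m \<bar>int (corner_dist i s) - int (corner_dist k s)\<bar>
      - gain m (int (corner_dist k s) - int (corner_dist j s))
      - detour_gain m (int (corner_dist k s) - int (corner_dist j s))
      + 3 ^ Suc m * (int (diam m) - int (corner_dist i s)) + 3 ^ m * int (diam m) + detour_gain m (int (diam m))"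
proof -
  have len: "length s = m"
    by (rule length_words[OF assms(7)])
  note g1 = rel_total_Cons[OF assms(1-6), of "j # s" "Suc m"]
  note g2 = rel_total_Cons[OF assms(2,1,3) assms(4)[symmetric] assms(6,5) len]
  note cd = int_corner_dist[OF assms(1-7)]
  have "\<bar>int (corner_dist j (j # s)) - int (corner_dist k (j # s))\<bar> =
      int (weight m) + (int (corner_dist k s) - int (corner_dist j s))"
    using cd(3) assms(6) len by (auto simp: weight_def)
  moreover have "int (corner_dist k s) - int (corner_dist j s) \<le> int (diam m)"
    using cd(4) by simp
  ultimately have "rel_total (i # j # s) = rel_total (j # s) - 3 ^ Suc m * int (corner_dist i (j # s))
     - (gain m (int (corner_dist k s) - int (corner_dist j s))
      + detour_gain m (int (corner_dist k s) - int (corner_dist j s)))"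
    using g1 len detour_gain_Suc_weight[OF assms(8)] by simp
  then show ?thesis
    unfolding g2 min_total_Suc[OF assms(8)] using assms(4) len by (simp add: algebra_simps)
qed

lemma detour_gain_half':
  assumes "0 \<le> b" "b \<le> int (diam m)"
  shows "2 * detour_gain m b \<le> (3 ^ m - 1) * b"
proof (cases "int (link m) \<le> b")
  case True
  then have "2 * detour_gain m b \<le> (3 ^ m - 1) * (b - int (link m))"
    using assms by (intro detour_gain_half) (auto simp: weight_def)
  also have "\<dots> \<le> (3 ^ m - 1) * b"
    by (intro mult_left_mono) auto
  finally show ?thesis .
next
  case False
  then show ?thesis
    using assms by (simp add: detour_gain_eq_0)
qed

text \<open>Lower bounds for \<open>rel_total (i # j # x # t) - min_total (m + 2)\<close>, for t of length \<open>m > 0\<close> with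
  distances a, b, e to the corners i, j, k, in the cases x = j, x = k and x = i. Here g is
  \<open>rel_total t\<close>. The expressions result from unfolding the recursions.\<close>

context
  fixes m :: nat and a b e g :: int
  assumes range: "0 \<le> a" "a \<le> int (diam m)" "0 \<le> b" "b \<le> int (diam m)" "0 \<le> e" "e \<le> int (diam m)"
    and sum: "a + b + e = 2 * int (diam m)"
begin

lemma descent_second:
  assumes "g \<ge> - (3 ^ m * b)"
  shows "b \<le> g + 9 * (3 ^ m * int (diam m)) - 7 * (3 ^ m * a) - 2 * detour_gain m \<bar>a - e\<bar>
    - detour_gain m \<bar>b - e\<bar> - 2 * gain m (e - b) + detour_gain m (int (diam m))"
proof -
  let ?D = "int (diam m)" and ?Q = "(3::int) ^ m"
  have "detour_gain m \<bar>a - e\<bar> \<le> detour_gain m (b + 2 * (?D - a))"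
    using sum range by (intro detour_gain_mono) auto
  moreover have "detour_gain m (b + 2 * (?D - a)) \<le> detour_gain m b + ?Q * (2 * (?D - a))"
    using detour_gain_slope[of b "b + 2 * (?D - a)" m] range by simp
  moreover have "detour_gain m \<bar>b - e\<bar> \<le> detour_gain m ?D"
    using range by (intro detour_gain_mono) auto
  moreover have "2 * gain m (e - b) \<le> ?Q * (e - b + ?D)"
    using range by (intro gain_chord) auto
  \<comment> \<open>The other estimates together leave 2 * ?Q * (?D - a), which is nonnegative; the
    b on the left of the claim comes from the - 1 here.\<close>
  moreover have "2 * detour_gain m b \<le> (?Q - 1) * b"
    using range by (intro detour_gain_half')
  moreover have "?Q * (a + b + e) = ?Q * (2 * ?D)"
    by (simp only: sum)
  moreover have "?Q * a \<le> ?Q * ?D"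
    using range by (intro mult_left_mono) auto
  ultimately show ?thesis
    using assms unfolding ring_distribs by linarith
qed

lemma descent_third:
  assumes "g \<ge> - (3 ^ m * e)"
  shows "e \<le> g - 3 ^ m * e - 3 * (3 ^ m * b) + 13 * (3 ^ m * int (diam m)) - 9 * (3 ^ m * a)
    - detour_gain m \<bar>a - b\<bar> - gain m (a - e) - detour_gain m (a - e)
    - gain m (e - b) - detour_gain m (e - b) + detour_gain m (int (diam m))"
proof -
  let ?D = "int (diam m)" and ?Q = "(3::int) ^ m"
  have "detour_gain m \<bar>a - b\<bar> \<le> detour_gain m (e + 2 * (?D - a))"
    using sum range by (intro detour_gain_mono) auto
  moreover have "detour_gain m (e + 2 * (?D - a)) \<le> detour_gain m e + ?Q * (2 * (?D - a))"
    using detour_gain_slope[of e "e + 2 * (?D - a)" m] range by simp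
  moreover have "gain m (a - e) \<le> gain m (?D - e)" "detour_gain m (a - e) \<le> detour_gain m (?D - e)"
    using range by (auto intro: gain_mono detour_gain_mono)
  \<comment> \<open>Reflection splits off the linear part. The rest, \<open>gain m (e - ?D)\<close>,
    is written as a detour gain so that \<open>detour_gain_half\<close> bounds it with the factor ?Q
    - 1.\<close>
  moreover have "gain m (?D - e) = ?Q * (?D - e) + detour_gain m (e + int (link m))"
    using gain_reflect[of m "?D - e"] by (simp add: detour_gain_def weight_def)
  moreover have "gain m (e - b) \<le> gain m (2 * e - ?D)" "detour_gain m (e - b) \<le> detour_gain m (2 * e - ?D)"
    using sum range by (auto intro: gain_mono detour_gain_mono)
  moreover have "2 * gain m (2 * e - ?D) \<le> ?Q * (2 * e - ?D + ?D)"
    using range by (intro gain_chord) auto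
  \<comment> \<open>The two arguments add up to e, so superadditivity merges the terms if both
    arguments are nonnegative.\<close>
  moreover have "detour_gain m (?D - e) + detour_gain m (2 * e - ?D) \<le> detour_gain m ?D"
  proof (cases "2 * e \<ge> ?D")
    case True
    then have "detour_gain m (?D - e) + detour_gain m (2 * e - ?D) \<le> detour_gain m e"
      using detour_gain_superadditive[of "?D - e" "2 * e - ?D" m] range by simp
    also have "\<dots> \<le> detour_gain m ?D"
      using range by (intro detour_gain_mono) auto
    finally show ?thesis .
  next
    case False
    then have "detour_gain m (2 * e - ?D) = 0"
      by (intro detour_gain_eq_0) auto
    moreover have "detour_gain m (?D - e) \<le> detour_gain m ?D"
      using range by (intro detour_gain_mono) auto
    ultimately show ?thesis
      by simp
  qed
  \<comment> \<open>This bound and the next one each supply half of the e on the left of the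
    claim.\<close>
  moreover have "2 * detour_gain m e \<le> (?Q - 1) * e"
    using range by (intro detour_gain_half')
  moreover have "2 * detour_gain m (e + int (link m)) \<le> (?Q - 1) * e"
    using range detour_gain_half[of "e + int (link m)" m] by (simp add: weight_def)
  moreover have "?Q * (a + b + e) = ?Q * (2 * ?D)"
    by (simp only: sum)
  moreover have "?Q * a \<le> ?Q * ?D"
    using range by (intro mult_left_mono) auto
  ultimately show ?thesis
    using assms unfolding ring_distribs by linarith
qed

lemma descent_first:
  assumes "g \<ge> - (3 ^ m * a)"
  shows "0 < g + 8 * (3 ^ m * int (weight m)) + 13 * (3 ^ m * int (diam m)) - 10 * (3 ^ m * a)
    - 2 * (3 ^ m * b) - 3 ^ m * e - 2 * detour_gain m \<bar>b - e\<bar> - gain m (e - a) - detour_gain m (e - a)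
    - gain m (e - b) - detour_gain m (e - b) + detour_gain m (int (diam m))"
proof -
  let ?D = "int (diam m)" and ?Q = "(3::int) ^ m"
  have "detour_gain m \<bar>b - e\<bar> \<le> detour_gain m ?D" "detour_gain m (e - a) \<le> detour_gain m ?D"
    "detour_gain m (e - b) \<le> detour_gain m ?D"
    using range by (auto intro!: detour_gain_mono)
  moreover have "detour_gain m ?D \<le> ?Q * ?D"
    by (rule detour_gain_le) simp
  moreover have "gain m (e - a) \<le> gain m ?D" "gain m (e - b) \<le> gain m ?D" "gain m ?D = ?Q * ?D"
    using range by (auto intro: gain_mono gain_eq)
  moreover have "?Q * a \<le> ?Q * ?D" "?Q * b \<le> ?Q * ?D" "?Q * e \<le> ?Q * ?D"
    using range by (auto intro!: mult_left_mono)
  moreover have "?Q * ?D \<le> ?Q * int (weight m)" "0 < ?Q * int (weight m)"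
    using weight_pos[of m] by (auto simp: weight_def)
  ultimately show ?thesis
    using assms by linarith
qed

end

section \<open>The minimum of \<open>rel_total\<close> and the words that attain it\<close>

lemma rel_total_split_ge:
  assumes "i \<in> T" "j \<in> T" "i \<noteq> j" "s \<in> words m"
  shows "min_total (Suc m) \<le> rel_total (i # j # s) \<and>
    (rel_total (i # j # s) = min_total (Suc m) \<longrightarrow> (\<exists>h\<in>T. h \<noteq> i \<and> s = replicate m h))"
proof -
  define k where "k = 3 - i - j"
  note td = third_digit[OF assms(1-3), folded k_def]
  note ijk = assms(1,2) td(1) assms(3) td(2,3)[symmetric]
  \<comment> \<open>The general case splits off one more digit and uses
    \<open>detour_gain_Suc\<close> at the length p of the rest, which must be positive. There the
    difference to the minimum is positive for x = i; for x = j or x = k it is at least the distance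
    from the rest to the corner x, so it vanishes only if the rest repeats x.\<close>
  consider "m = 0" | "m = 1" | p where "m = Suc p" "p > 0"
    by (cases m; cases "m = 1") auto
  then show ?thesis
  proof cases
    case 1
    then show ?thesis
      using assms rel_total_Cons_replicate[OF assms(1-3), of 1] by auto
  next
    case 2
    then obtain x where s: "s = [x]" "x = i \<or> x = j \<or> x = k"
      using assms(4) td(4) by (cases s) (auto simp: words_def)
    then have rel0: "rel_total s = 0"
      using rel_total_replicate[of x 1] ijk by auto
    have cd: "int (corner_dist h s) = (if x = h then 0 else 1)" for h
      by (simp add: s(1) weight_def link_def)
    have diam1: "int (diam (Suc 0)) = 1"
      by (simp add: link_def)
    have gain1: "gain (Suc 0) 1 = 3" "gain (Suc 0) 0 = 1" "gain (Suc 0) (-1) = 0"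
      by (simp_all add: weight_def link_def)
    have detour0: "detour_gain (Suc 0) 0 = 0" "detour_gain (Suc 0) (-1) = 0"
      by (simp_all add: detour_gain_eq_0)
    have m_pos: "m > 0"
      using 2 by simp
    have F: "rel_total (i # j # s) - min_total (Suc m) = (if x = i then 8 else 0)"
      unfolding rel_total_Cons_Cons[OF ijk assms(4) m_pos]
      unfolding 2 One_nat_def rel0 cd diam1 using s(2) ijk(4-6)
      by (elim disjE) (simp_all add: gain1 detour0 del: gain.simps)
    have "s = replicate m x" "x \<in> T"
      using s ijk 2 by auto
    then show ?thesis
      using F by (auto split: if_splits)
  next
    case 3
    then obtain x t where s: "s = x # t" "x \<in> T" "t \<in> words p"
      using assms(4) by (auto elim: words_Suc_cases)
    have x_cases: "x = i \<or> x = j \<or> x = k"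
      using s(2) td(4) by auto
    note m = \<open>m = Suc p\<close>
    define a b e where "a = int (corner_dist i t)" and "b = int (corner_dist j t)" and "e = int (corner_dist k t)"
    note abe = int_corner_dist[OF ijk s(3), folded a_def b_def e_def]
    have ran: "0 \<le> a" "a \<le> int (diam p)" "0 \<le> b" "b \<le> int (diam p)" "0 \<le> e" "e \<le> int (diam p)"
      using abe by (auto simp: a_def b_def e_def)
    have len: "length t = p"
      by (rule length_words[OF s(3)])
    have m_pos: "m > 0"
      by (simp add: m)
    note F = rel_total_Cons_Cons[OF ijk assms(4) m_pos]
    have top: "detour_gain (Suc p) (int (diam (Suc p))) = 3 ^ p * int (diam p) + detour_gain p (int (diam p))"
      using detour_gain_Suc_weight[OF 3(2), of "int (diam p)"] by (simp add: gain_eq weight_def algebra_simps)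
    have small: "detour_gain (Suc p) y = detour_gain p y" if "y \<le> int (diam p)" for y
      using detour_gain_Suc[OF 3(2), of y] that detour_gain_eq_0[of "y - int (weight p)" p]
      by (simp add: weight_def)
    note large = detour_gain_Suc_weight[OF 3(2)]
    have refl: "gain p (int (weight p) + v) = 3 ^ p * (int (weight p) + v) + detour_gain p (- v)" for v
      using gain_reflect[of p "int (weight p) + v"] by (simp add: detour_gain_def algebra_simps)
    have big: "gain p (int (weight p) + int (weight p) + v) = 3 ^ p * (2 * int (weight p) + v)"
      if "- int (diam p) \<le> v" for v
      using that by (subst gain_eq) (auto simp: weight_def algebra_simps)
    have zero: "gain p (v - int (weight p) - int (weight p)) = 0" if "v \<le> int (diam p)" for v
      using that by (intro gain_eq_0) (auto simp: weight_def)
    have abs: "detour_gain p \<bar>y\<bar> = detour_gain p y + detour_gain p (- y)" for y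
      by (cases "y \<ge> 0") (auto simp: detour_gain_eq_0)
    have diam: "int (diam (Suc p)) = int (diam p) + int (weight p)"
      by (simp add: weight_def)
    have sum: "3 ^ p * a + 3 ^ p * b + 3 ^ p * e = 2 * (3 ^ p * int (diam p))"
      using abe(1) by (simp flip: distrib_left)
    have ge: "rel_total t \<ge> - (3 ^ p * a)" "rel_total t \<ge> - (3 ^ p * b)" "rel_total t \<ge> - (3 ^ p * e)"
      unfolding a_def b_def e_def by (intro rel_total_ge s(3) ijk)+
    from x_cases show ?thesis
    proof (elim disjE)
      assume x: "x = i"
      have cd: "int (corner_dist i s) = a" "int (corner_dist j s) = int (weight p) + b"
        "int (corner_dist k s) = int (weight p) + e"
        using ijk len by (auto simp: s(1) x a_def b_def e_def)
      have v: "\<bar>a - (int (weight p) + e)\<bar> = int (weight p) + (e - a)"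
        using ran by (auto simp: weight_def)
      have 1: "detour_gain (Suc p) (int (weight p) + (e - a)) = gain p (e - a) + detour_gain p (e - a)"
        using ran by (intro large) auto
      have 2: "gain (Suc p) (int (weight p) + e - (int (weight p) + b)) =
          3 ^ p * (int (weight p) + (e - b)) + detour_gain p (b - e) + gain p (e - b) + detour_gain p (e - b)"
        using refl[of "e - b"] by (simp add: detour_gain_def algebra_simps)
      have 3: "detour_gain (Suc p) (int (weight p) + e - (int (weight p) + b)) = detour_gain p (e - b)"
        using ran small[of "e - b"] by simp
      have "rel_total (i # j # s) - min_total (Suc m) > 0"
        unfolding m unfolding F[unfolded cd m v 1 2 3 diam top[unfolded diam]]
        using descent_first[OF ran abe(1) ge(1)] abs[of "b - e"]
          rel_total_Cons[OF ijk len, folded a_def b_def e_def s(1)[unfolded x]]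
        unfolding ring_distribs power_Suc minus_diff_eq by linarith
      then show ?thesis
        by linarith
    next
      assume x: "x = j"
      have cd: "int (corner_dist i s) = int (weight p) + a" "int (corner_dist j s) = b"
        "int (corner_dist k s) = int (weight p) + e"
        using ijk len by (auto simp: s(1) x a_def b_def e_def)
      have v: "\<bar>int (weight p) + a - (int (weight p) + e)\<bar> = \<bar>a - e\<bar>"
        "int (weight p) + e - b = int (weight p) + (e - b)"
        by auto
      have 1: "detour_gain (Suc p) (int (weight p) + (e - b)) = gain p (e - b) + detour_gain p (e - b)"
        using ran by (intro large) auto
      have 2: "gain (Suc p) (int (weight p) + (e - b)) = 3 ^ p * (2 * int (weight p) + (e - b)) +
          (3 ^ p * (int (weight p) + (e - b)) + detour_gain p (b - e)) + gain p (e - b)"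
        using refl[of "e - b"] big[of "e - b"] ran by (simp add: algebra_simps)
      have 3: "detour_gain (Suc p) \<bar>a - e\<bar> = detour_gain p \<bar>a - e\<bar>"
        using ran by (intro small) auto
      have ge_b: "rel_total (i # j # s) - min_total (Suc m) \<ge> b"
        unfolding m unfolding F[unfolded cd m v 1 2 3 diam top[unfolded diam]]
        using descent_second[OF ran abe(1) ge(2)] abs[of "b - e"] sum
          rel_total_Cons[OF ijk(2,1,3) ijk(4)[symmetric] ijk(6,5) len, folded a_def b_def e_def s(1)[unfolded x]]
        unfolding ring_distribs power_Suc minus_diff_eq by linarith
      have eq: "s = replicate m j" if "b = 0"
        using that corner_dist_eq_0[OF s(3)] by (simp add: b_def s(1) x m)
      show ?thesis
      proof (intro conjI impI bexI[of _ j])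
        show "s = replicate m j" if "rel_total (i # j # s) = min_total (Suc m)"
          using ge_b ran that by (intro eq) linarith
      qed (use ge_b ran ijk in \<open>auto\<close>)
    next
      assume x: "x = k"
      have cd: "int (corner_dist i s) = int (weight p) + a" "int (corner_dist j s) = int (weight p) + b"
        "int (corner_dist k s) = e"
        using ijk len by (auto simp: s(1) x a_def b_def e_def)
      have v: "\<bar>int (weight p) + a - e\<bar> = int (weight p) + (a - e)"
        "e - (int (weight p) + b) = e - b - int (weight p)"
        using ran by (auto simp: weight_def)
      have 1: "detour_gain (Suc p) (int (weight p) + (a - e)) = gain p (a - e) + detour_gain p (a - e)"
        using ran by (intro large) auto
      have 2: "gain (Suc p) (e - b - int (weight p)) = gain p (e - b) + detour_gain p (e - b)"
        using zero[of "e - b"] ran by (simp add: detour_gain_def)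
      have 3: "detour_gain (Suc p) (e - b - int (weight p)) = 0"
        using ran by (intro detour_gain_eq_0) (auto simp: weight_def)
      have ge_e: "rel_total (i # j # s) - min_total (Suc m) \<ge> e"
        unfolding m unfolding F[unfolded cd m v 1 2 3 diam top[unfolded diam]]
        using descent_third[OF ran abe(1) ge(3)] sum
          rel_total_Cons[OF ijk(3,1,2) ijk(5,6)[symmetric] ijk(4) len, folded a_def b_def e_def s(1)[unfolded x]]
        unfolding ring_distribs power_Suc minus_diff_eq by linarith
      have eq: "s = replicate m k" if "e = 0"
        using that corner_dist_eq_0[OF s(3)] by (simp add: e_def s(1) x m)
      show ?thesis
      proof (intro conjI impI bexI[of _ k])
        show "s = replicate m k" if "rel_total (i # j # s) = min_total (Suc m)"
          using ge_e ran that by (intro eq) linarith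
      qed (use ge_e ran ijk in \<open>auto\<close>)
    qed
  qed
qed

text \<open>With a repeated digit, corner i is at most \<open>diam m\<close> away instead of the
  possible \<open>weight m + diam m\<close>. This loss, taken 3^(m+1) times, outweighs all that
  \<open>rel_total (i # r)\<close> can contribute.\<close>

lemma rel_total_same_gt:
  assumes "i \<in> T" "r \<in> words m" "min_total m \<le> rel_total (i # r)"
  shows "min_total (Suc m) < rel_total (i # i # r)"
proof -
  obtain j k where jk: "j \<in> T" "k \<in> T" "i \<noteq> j" "i \<noteq> k" "j \<noteq> k"
    using assms(1) by (rule obtain_digits)
  have len: "length r = m"
    by (rule length_words[OF assms(2)])
  note cd = int_corner_dist[OF assms(1) jk assms(2)]
  let ?D = "int (diam m)" and ?W = "int (weight m)" and ?Q = "(3::int) ^ m"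
  let ?y = "\<bar>int (corner_dist j r) - int (corner_dist k r)\<bar>"
  have "rel_total (i # i # r) = rel_total (i # r) - 3 * (?Q * int (corner_dist i r)) - detour_gain (Suc m) ?y"
    using rel_total_Cons[OF assms(1) jk, of "i # r" "Suc m"] jk len by simp
  moreover have "?Q * int (corner_dist i r) \<le> ?Q * ?D"
    using cd by (intro mult_left_mono) auto
  moreover have "detour_gain (Suc m) ?y \<le> detour_gain (Suc m) (?W + ?D)"
    using cd by (intro detour_gain_mono) auto
  moreover have "min_total m = - (?Q * ?D) - detour_gain m ?D"
    by (simp add: min_total_def)
  moreover have "min_total (Suc m) = - (3 * (?Q * (?W + ?D))) - detour_gain (Suc m) (?W + ?D)"
    by (simp add: min_total_def weight_def)
  moreover have "detour_gain m ?D \<le> ?Q * ?D"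
    by (rule detour_gain_le) simp
  moreover have "?Q * ?D \<le> ?Q * ?W" "0 < ?Q * ?W"
    using weight_pos[of m] by (auto simp: weight_def)
  ultimately show ?thesis
    using assms(3) unfolding ring_distribs by linarith
qed

lemma rel_total_ge_min_total: "s \<in> words (Suc m) \<Longrightarrow> min_total m \<le> rel_total s"
proof (induction m arbitrary: s)
  case 0
  then obtain x where "x \<in> T" "s = replicate 1 x"
    by (auto elim: words_Suc_cases)
  then show ?case
    using rel_total_replicate[of x 1] by (simp add: min_total_def detour_gain_eq_0)
next
  case (Suc m)
  from Suc.prems obtain i t where t: "s = i # t" "i \<in> T" "t \<in> words (Suc m)"
    by (rule words_Suc_cases)
  from t(3) obtain j r where r: "t = j # r" "j \<in> T" "r \<in> words m"
    by (rule words_Suc_cases)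
  show ?case
  proof (cases "i = j")
    case True
    then show ?thesis
      using rel_total_same_gt[OF t(2) r(3)] Suc.IH[OF t(3)] unfolding t(1) r(1) by simp
  next
    case False
    then show ?thesis
      using rel_total_split_ge[OF t(2) r(2) _ r(3)] unfolding t(1) r(1) by simp
  qed
qed

lemma rel_total_split_replicate:
  assumes "i \<in> T" "j \<in> T" "h \<in> T" "i \<noteq> j" "i \<noteq> h"
  shows "rel_total (i # j # replicate m h) = min_total (Suc m)"
proof (cases "j = h \<or> m = 0")
  case True
  then show ?thesis
    using rel_total_Cons_replicate[OF assms(1,2,4), of "Suc m"] by auto
next
  case False
  then show ?thesis
    using rel_total_Cons_Cons[OF assms(1-5) _ replicate_words[OF assms(3)], of m] assms
    by (simp add: rel_total_replicate corner_dist_replicate gain_eq_0 detour_gain_eq_0)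
qed

lemma rel_total_minimal:
  assumes "s \<in> words (Suc (Suc m))"
  shows "rel_total s = min_total (Suc m) \<longleftrightarrow>
    (\<exists>i\<in>T. \<exists>j\<in>T. \<exists>h\<in>T. i \<noteq> j \<and> i \<noteq> h \<and> s = i # j # replicate m h)"
proof
  assume eq: "rel_total s = min_total (Suc m)"
  from assms obtain i t where t: "s = i # t" "i \<in> T" "t \<in> words (Suc m)"
    by (rule words_Suc_cases)
  from t(3) obtain j r where r: "t = j # r" "j \<in> T" "r \<in> words m"
    by (rule words_Suc_cases)
  have s: "s = i # j # r"
    using t(1) r(1) by simp
  have "i \<noteq> j"
  proof
    assume "i = j"
    then show False
      using rel_total_same_gt[OF t(2) r(3)] rel_total_ge_min_total[OF t(3)] eq
      unfolding s r(1) by simp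
  qed
  moreover from this obtain h where "h \<in> T" "h \<noteq> i" "r = replicate m h"
    using rel_total_split_ge[OF t(2) r(2) _ r(3)] eq unfolding s by metis
  ultimately show "\<exists>i\<in>T. \<exists>j\<in>T. \<exists>h\<in>T. i \<noteq> j \<and> i \<noteq> h \<and> s = i # j # replicate m h"
    using s t(2) r(2) by metis
next
  assume "\<exists>i\<in>T. \<exists>j\<in>T. \<exists>h\<in>T. i \<noteq> j \<and> i \<noteq> h \<and> s = i # j # replicate m h"
  then show "rel_total s = min_total (Suc m)"
    using rel_total_split_replicate by metis
qed

definition total_wdist :: "nat list \<Rightarrow> nat" where
  "total_wdist s = (\<Sum>t\<in>words (length s). wdist s t)"

lemma total_wdist_minimal:
  assumes "s \<in> words (Suc (Suc m))"
  shows "(\<forall>t\<in>words (Suc (Suc m)). total_wdist s \<le> total_wdist t) \<longleftrightarrow>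
    (\<exists>i\<in>T. \<exists>j\<in>T. \<exists>h\<in>T. i \<noteq> j \<and> i \<noteq> h \<and> s = i # j # replicate m h)"
proof -
  \<comment> \<open>A sample word at which the lower bound is attained.\<close>
  let ?w = "0 # 1 # replicate m 1 :: nat list"
  have w: "?w \<in> words (Suc (Suc m))" "rel_total ?w = min_total (Suc m)"
    by (auto simp: T_def intro: rel_total_split_replicate[unfolded T_def])
  obtain K where "\<And>t. t \<in> words (Suc (Suc m)) \<Longrightarrow>
      (\<Sum>u\<in>words (Suc (Suc m)). int (wdist t u)) = rel_total t + K"
    using sum_wdist by blast
  then have total: "int (total_wdist t) = rel_total t + K" if "t \<in> words (Suc (Suc m))" for t
    using that by (simp add: total_wdist_def length_words)
  have "total_wdist s \<le> total_wdist t \<longleftrightarrow> rel_total s \<le> rel_total t" if "t \<in> words (Suc (Suc m))" for t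
    using total[OF assms] total[OF that] by linarith
  then have "(\<forall>t\<in>words (Suc (Suc m)). total_wdist s \<le> total_wdist t) \<longleftrightarrow>
      (\<forall>t\<in>words (Suc (Suc m)). rel_total s \<le> rel_total t)"
    by blast
  also have "\<dots> \<longleftrightarrow> rel_total s = min_total (Suc m)"
  proof
    assume "\<forall>t\<in>words (Suc (Suc m)). rel_total s \<le> rel_total t"
    then have "rel_total s \<le> min_total (Suc m)"
      using w by metis
    then show "rel_total s = min_total (Suc m)"
      using rel_total_ge_min_total[OF assms] by simp
  qed (use rel_total_ge_min_total in auto)
  finally show ?thesis
    by (simp only: rel_total_minimal[OF assms])
qed

end

subsection \<open>Distances in the Sierpinski graph\<close>

lemma sedge_append: "sedge m u v \<Longrightarrow> set s \<subseteq> T \<Longrightarrow> sedge m (s @ u) (s @ v)"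
  by (induction s) (auto intro: sedge.Cons)

lemma sedge_iff: "sedge m u v \<longleftrightarrow> (\<exists>s i j. set s \<subseteq> T \<and> i \<in> T \<and> j \<in> T \<and> i \<noteq> j \<and>
    u = s @ i # replicate m j \<and> v = s @ j # replicate m i)"
proof
  assume "sedge m u v"
  then show "\<exists>s i j. set s \<subseteq> T \<and> i \<in> T \<and> j \<in> T \<and> i \<noteq> j \<and>
    u = s @ i # replicate m j \<and> v = s @ j # replicate m i"
  proof induction
    case (top i j m)
    then show ?case
      by (intro exI[of _ "[]"]) auto
  next
    case (Cons m u v h)
    then obtain s i j where "set s \<subseteq> T" "i \<in> T" "j \<in> T" "i \<noteq> j"
      "u = s @ i # replicate m j" "v = s @ j # replicate m i"
      by blast
    then show ?case
      using Cons.hyps(2) by (intro exI[of _ "h # s"]) auto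
  qed
qed (auto intro: sedge_append sedge.top)

text \<open>Guarantees that a clique edge is not a non-clique edge as well, so its ends are not
  contracted together.\<close>

lemma sedge_unique: "sedge m u v \<Longrightarrow> sedge m' u v \<Longrightarrow> m = m'"
proof (induction rule: sedge.induct)
  case (top i j m)
  from top(4) top(1-3) show ?case
    by (cases rule: sedge.cases) (auto dest: arg_cong[of _ _ length])
next
  case (Cons m u v h)
  from Cons.prems show ?case
    by (cases rule: sedge.cases) (auto intro: Cons.IH)
qed

lemma sedge_neq: "sedge m u v \<Longrightarrow> u \<noteq> v"
  by (induction rule: sedge.induct) auto

lemma S_edge_iff_sedge:
  "(\<exists>s i j. s \<in> words (N - Suc m) \<and> i \<in> T \<and> j \<in> T \<and> i \<noteq> j \<and> Suc m \<le> N \<and> {u, v} = S_edge s i j (Suc m))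
    \<longleftrightarrow> u \<in> words N \<and> sedge m u v" (is "?L \<longleftrightarrow> ?R")
proof
  assume ?L
  then obtain s i j where *: "s \<in> words (N - Suc m)" "i \<in> T" "j \<in> T" "i \<noteq> j" "Suc m \<le> N"
    "{u, v} = S_edge s i j (Suc m)"
    by blast
  have "sedge m (s @ i # replicate m j) (s @ j # replicate m i)"
    using * by (auto simp: sedge_iff words_def)
  moreover from this have "sedge m (s @ j # replicate m i) (s @ i # replicate m j)"
    by (rule sedge_sym)
  ultimately have "sedge m u v"
    using *(6) by (auto simp: S_edge_def doubleton_eq_iff)
  moreover have "u \<in> words N"
    using * by (auto simp: S_edge_def doubleton_eq_iff words_def)
  ultimately show ?R
    by simp
next
  assume ?R
  then obtain s i j where "set s \<subseteq> T" "i \<in> T" "j \<in> T" "i \<noteq> j" "u \<in> words N"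
    "u = s @ i # replicate m j" "v = s @ j # replicate m i"
    by (auto simp: sedge_iff)
  then show ?L
    by (intro exI[of _ s] exI[of _ i] exI[of _ j]) (auto simp: words_def S_edge_def)
qed

lemma S_edges_iff: "{u, v} \<in> S_edges N \<longleftrightarrow> u \<in> words N \<and> (\<exists>m. sedge m u v)"
proof
  assume "{u, v} \<in> S_edges N"
  then obtain s i j d where *: "s \<in> words (N - d)" "i \<in> T" "j \<in> T" "i \<noteq> j" "1 \<le> d" "d \<le> N"
    "{u, v} = S_edge s i j d"
    unfolding S_edges_def by blast
  then obtain m where "d = Suc m"
    by (cases d) auto
  then show "u \<in> words N \<and> (\<exists>m. sedge m u v)"
    using S_edge_iff_sedge[of N m u v] * by blast
next
  assume "u \<in> words N \<and> (\<exists>m. sedge m u v)"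
  then obtain m s i j where "s \<in> words (N - Suc m)" "i \<in> T" "j \<in> T" "i \<noteq> j" "Suc m \<le> N"
    "{u, v} = S_edge s i j (Suc m)"
    by (metis S_edge_iff_sedge)
  moreover have "1 \<le> Suc m"
    by simp
  ultimately show "{u, v} \<in> S_edges N"
    unfolding S_edges_def by blast
qed

lemma clique_edges_iff: "{u, v} \<in> clique_edges N \<longleftrightarrow> u \<in> words N \<and> sedge 0 u v"
proof -
  have "{u, v} \<in> clique_edges N \<longleftrightarrow> (\<exists>s i j. s \<in> words (N - Suc 0) \<and> i \<in> T \<and> j \<in> T \<and> i \<noteq> j \<and>
      Suc 0 \<le> N \<and> {u, v} = S_edge s i j (Suc 0))"
    unfolding clique_edges_def mem_Collect_eq One_nat_def by blast
  then show ?thesis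
    by (simp only: S_edge_iff_sedge)
qed

lemma sedge_in_words: "sedge m u v \<Longrightarrow> u \<in> words N \<Longrightarrow> v \<in> words N"
  by (metis sedge_words sedge_length length_words)

lemma gdist_eqI:
  assumes "(u, v) \<in> adj_rel E ^^ k" "\<And>l. (u, v) \<in> adj_rel E ^^ l \<Longrightarrow> k \<le> l"
  shows "gdist E u v = k"
  unfolding gdist_def using assms by (rule Least_equality)

lemma walk_imp_relpow_S:
  "walk 1 k u v \<Longrightarrow> u \<in> words N \<Longrightarrow> (u, v) \<in> adj_rel (S_edges N) ^^ k"
proof (induction rule: walk.induct)
  case (step m u v k x)
  have "(u, v) \<in> adj_rel (S_edges N)"
    using step.hyps(1) step.prems by (auto simp: adj_rel_def S_edges_iff)
  then have "(u, x) \<in> adj_rel (S_edges N) ^^ Suc k"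
    by (rule relpow_Suc_I2) (intro step.IH sedge_in_words[OF step.hyps(1) step.prems])
  then show ?case
    by (simp add: link_def)
qed simp

lemma relpow_S_imp_wdist_le:
  "(u, v) \<in> adj_rel (S_edges N) ^^ k \<Longrightarrow> v \<in> words N \<Longrightarrow> wdist 1 u v \<le> k"
proof (induction k arbitrary: u)
  case (Suc k)
  from relpow_Suc_D2[OF Suc.prems(1)] obtain y
    where y: "(u, y) \<in> adj_rel (S_edges N)" "(y, v) \<in> adj_rel (S_edges N) ^^ k"
    by blast
  then obtain m where "sedge m u y" "u \<in> words N"
    by (auto simp: adj_rel_def S_edges_iff)
  then show ?case
    using sedge_wdist[of m u y v 1] Suc.IH[OF y(2) Suc.prems(2)] Suc.prems(2)
    by (simp add: link_def length_words split: if_splits)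
qed simp

lemma gdist_S:
  assumes "u \<in> words N" "v \<in> words N"
  shows "gdist (S_edges N) u v = wdist 1 u v"
  by (rule gdist_eqI[OF walk_imp_relpow_S[OF walk_wdist[OF assms] assms(1)]
        relpow_S_imp_wdist_le[OF _ assms(2)]])

lemma median_S:
  "median (S_verts (Suc (Suc m))) (S_edges (Suc (Suc m))) =
    {i # j # replicate m h | i j h. i \<in> T \<and> j \<in> T \<and> h \<in> T \<and> i \<noteq> j \<and> i \<noteq> h}"
proof -
  let ?N = "Suc (Suc m)"
  have "total_dist (S_verts ?N) (S_edges ?N) v = total_wdist 1 v" if "v \<in> words ?N" for v
    using that by (simp add: total_dist_def total_wdist_def S_verts_def gdist_S length_words)
  then have "median (S_verts ?N) (S_edges ?N) =
      {v \<in> words ?N. \<forall>w\<in>words ?N. total_wdist 1 v \<le> total_wdist 1 w}"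
    by (auto simp: median_def S_verts_def)
  also have "\<dots> = {v \<in> words ?N. \<exists>i\<in>T. \<exists>j\<in>T. \<exists>h\<in>T. i \<noteq> j \<and> i \<noteq> h \<and> v = i # j # replicate m h}"
    using total_wdist_minimal[of _ m 1] by blast
  also have "\<dots> = {i # j # replicate m h | i j h. i \<in> T \<and> j \<in> T \<and> h \<in> T \<and> i \<noteq> j \<and> i \<noteq> h}"
    by auto
  finally show ?thesis .
qed

subsection \<open>Distances in the Sierpinski triangle graph\<close>

text \<open>Embeds the triangle graph of the previous level as the copy i. Its primitive vertex j
  different from i is glued to the primitive vertex i of copy j, which gives a vertex named after
  the third digit.\<close>

fun prefix_digit :: "nat \<Rightarrow> tvertex \<Rightarrow> tvertex" where
  "prefix_digit i (Prim j) = (if i = j then Prim i else Word [3 - i - j])"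
| "prefix_digit i (Word w) = Word (i # w)"

text \<open>The vertex to which a nonempty word is contracted.\<close>

fun label :: "nat list \<Rightarrow> tvertex" where
  "label [] = undefined"
| "label [i] = Prim i"
| "label (i # s) = prefix_digit i (label s)"

lemma label_Cons: "s \<noteq> [] \<Longrightarrow> label (i # s) = prefix_digit i (label s)"
  by (cases s) auto

lemma label_replicate: "label (replicate (Suc m) i) = Prim i"
  by (induction m) (auto simp: label_Cons)

lemma label_append:
  assumes "i \<noteq> j" "m > 0"
  shows "label (s @ i # replicate m j) = Word (s @ [3 - i - j])"
proof (induction s)
  case Nil
  then show ?case
    using assms label_replicate[of "m - 1" j] by (simp add: label_Cons)
qed (simp add: label_Cons)

text \<open>Cut at the last change of digit, if there is one.\<close>

lemma words_Suc_form:
  assumes "u \<in> words (Suc n)"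
  obtains (extreme) i where "i \<in> T" "u = replicate (Suc n) i"
  | (inner) s i j m where "set s \<subseteq> T" "i \<in> T" "j \<in> T" "i \<noteq> j" "m > 0" "u = s @ i # replicate m j"
proof -
  have "(\<exists>i\<in>T. u = replicate (Suc n) i) \<or> (\<exists>s i j m. set s \<subseteq> T \<and> i \<in> T \<and> j \<in> T \<and> i \<noteq> j \<and> m > 0 \<and>
      u = s @ i # replicate m j)"
    using assms
  proof (induction n arbitrary: u)
    case (Suc n)
    from Suc.prems obtain h t where t: "u = h # t" "h \<in> T" "t \<in> words (Suc n)"
      by (rule words_Suc_cases)
    from Suc.IH[OF t(3)] show ?case
    proof (elim disjE exE bexE conjE)
      fix i assume "i \<in> T" "t = replicate (Suc n) i"
      then show ?case
      proof (cases "h = i")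
        case False
        then show ?thesis
          using t \<open>i \<in> T\<close> \<open>t = _\<close>
          by (intro disjI2 exI[of _ "[]"] exI[of _ h] exI[of _ i] exI[of _ "Suc n"]) auto
      qed (use t in auto)
    next
      fix s i j m assume "set s \<subseteq> T" "i \<in> T" "j \<in> T" "i \<noteq> j" "0 < (m::nat)" "t = s @ i # replicate m j"
      then show ?case
        using t by (intro disjI2 exI[of _ "h # s"] exI[of _ i] exI[of _ j] exI[of _ m]) auto
    qed
  qed (auto elim: words_Suc_cases)
  then show thesis
    using extreme inner by blast
qed

text \<open>A label that is not primitive determines s and, through the third digit, the set of i
  and j; the length then determines m.\<close>

lemma label_eq_imp:
  assumes "u \<in> words (Suc n)" "v \<in> words (Suc n)" "label u = label v"
  shows "u = v \<or> (\<exists>m>0. sedge m u v)"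
  using assms(1)
proof (cases rule: words_Suc_form)
  case (extreme i)
  from assms(2) show ?thesis
    by (cases rule: words_Suc_form) (use extreme assms(3) in \<open>auto simp: label_append label_replicate simp del: replicate_Suc\<close>)
next
  case (inner s i j m)
  note u = this
  from assms(2) show ?thesis
  proof (cases rule: words_Suc_form)
    case (extreme i)
    then show ?thesis
      using u assms(3) by (auto simp: label_append label_replicate simp del: replicate_Suc)
  next
    case (inner s' i' j' m')
    have s: "s' = s" and k: "3 - i - j = 3 - i' - j'"
      using assms(3) u inner by (auto simp: label_append)
    have m: "m' = m"
      using assms(1,2) u inner s by (auto simp: words_def)
    have "i' = i \<and> j' = j \<or> i' = j \<and> j' = i"
      using k u inner by (auto simp: T_def)
    then show ?thesis
      using u inner s m by (auto simp: sedge_iff)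
  qed
qed

lemma label_clique_neq:
  assumes "sedge 0 u v" "u \<in> words (Suc n)"
  shows "label u \<noteq> label v"
  using label_eq_imp[OF assms(2) sedge_in_words[OF assms]] sedge_unique[OF assms(1)] sedge_neq[OF assms(1)]
  by auto

lemma label_nonclique_eq: "sedge m u v \<Longrightarrow> m > 0 \<Longrightarrow> label u = label v"
  using third_digit(5) by (auto simp: sedge_iff label_append)

lemma label_in_ST_verts:
  assumes "u \<in> words (Suc n)"
  shows "label u \<in> ST_verts n"
  using assms
proof (cases rule: words_Suc_form)
  case (extreme i)
  then show ?thesis
    by (simp add: label_replicate ST_verts_def del: replicate_Suc)
next
  case (inner s i j m)
  then have "length s + m = n"
    using assms by (auto simp: words_def)
  then show ?thesis
    using inner third_digit(1)[of i j]
    by (auto simp: label_append ST_verts_def words_def intro!: bexI[of _ "Suc (length s)"])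
qed

lemma ST_verts_label:
  assumes "x \<in> ST_verts n"
  obtains u where "u \<in> words (Suc n)" "label u = x"
proof -
  from assms consider i where "i \<in> T" "x = Prim i" | l w where "1 \<le> l" "l \<le> n" "w \<in> words l" "x = Word w"
    by (auto simp: ST_verts_def)
  then show thesis
  proof cases
    case 1
    then show thesis
      using that[of "replicate (Suc n) i"] by (simp add: label_replicate del: replicate_Suc)
  next
    case 2
    then obtain s k where w: "w = s @ [k]" "k \<in> T" "set s \<subseteq> T" "length s = l - 1"
      by (cases w rule: rev_cases) (auto simp: words_def)
    from w(2) obtain i j where ij: "i \<in> T" "j \<in> T" "k \<noteq> i" "k \<noteq> j" "i \<noteq> j"
      by (rule obtain_digits)
    have "3 - i - j = k"
      using third_digit_unique(1)[of i j k] ij w(2) by auto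
    then show thesis
      using that[of "s @ i # replicate (Suc n - l) j"] 2 w ij by (auto simp: label_append words_def)
  qed
qed

lemma vert_contracts_iff: "vert_contracts_to n v x \<longleftrightarrow> v \<in> words (Suc n) \<and> x = label v"
proof
  assume "vert_contracts_to n v x"
  then consider i where "i \<in> T" "v = replicate (Suc n) i" "x = Prim i"
    | s i j d where "s \<in> words (n + 1 - d)" "i \<in> T" "j \<in> T" "i \<noteq> j" "1 < d" "d \<le> n + 1"
        "v \<in> S_edge s i j d" "x = Word (s @ [3 - i - j])"
    unfolding vert_contracts_to_def edge_contracts_to_def by auto
  then show "v \<in> words (Suc n) \<and> x = label v"
  proof cases
    case 1
    then show ?thesis
      by (simp add: label_replicate del: replicate_Suc)
  next
    case 2
    then show ?thesis
      using third_digit(5)[of i j] by (auto simp: S_edge_def label_append words_def)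
  qed
next
  assume v: "v \<in> words (Suc n) \<and> x = label v"
  then have "v \<in> words (Suc n)" ..
  then show "vert_contracts_to n v x"
  proof (cases rule: words_Suc_form)
    case (extreme i)
    then show ?thesis
      using v by (auto simp: vert_contracts_to_def label_replicate simp del: replicate_Suc)
  next
    case (inner s i j m)
    have len: "length s + m = n"
      using v inner by (auto simp: words_def)
    let ?e = "S_edge s i j (Suc m)"
    have *: "s \<in> words (n + 1 - Suc m) \<and> i \<in> T \<and> j \<in> T \<and> i \<noteq> j \<and> 1 < Suc m \<and> Suc m \<le> n + 1"
      using inner len by (auto simp: words_def)
    then have "?e \<in> nonclique_edges (n + 1)"
      unfolding nonclique_edges_def by blast
    moreover have "edge_contracts_to n ?e x"
      unfolding edge_contracts_to_def using * v inner
      by (intro exI[of _ s] exI[of _ i] exI[of _ j] exI[of _ "Suc m"]) (auto simp: label_append)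
    moreover have "v \<in> ?e"
      using inner by (simp add: S_edge_def)
    ultimately show ?thesis
      unfolding vert_contracts_to_def by blast
  qed
qed

lemma ST_edges_iff:
  "{x, y} \<in> ST_edges n \<longleftrightarrow> (\<exists>u v. u \<in> words (Suc n) \<and> sedge 0 u v \<and> x = label u \<and> y = label v)"
proof
  assume "{x, y} \<in> ST_edges n"
  then obtain u v where uv: "u \<in> words (Suc n)" "v \<in> words (Suc n)" "sedge 0 u v"
    "{x, y} = {label u, label v}"
    by (auto simp: ST_edges_def vert_contracts_iff clique_edges_iff)
  then have "x = label u \<and> y = label v \<or> x = label v \<and> y = label u"
    by (auto simp: doubleton_eq_iff)
  then show "\<exists>u v. u \<in> words (Suc n) \<and> sedge 0 u v \<and> x = label u \<and> y = label v"
    using uv sedge_sym[OF uv(3)] by blast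
next
  assume "\<exists>u v. u \<in> words (Suc n) \<and> sedge 0 u v \<and> x = label u \<and> y = label v"
  then obtain u v where uv: "u \<in> words (Suc n)" "sedge 0 u v" "x = label u" "y = label v"
    by blast
  note v = sedge_in_words[OF uv(2,1)]
  have "vert_contracts_to n u x" "vert_contracts_to n v y" "{u, v} \<in> clique_edges (n + 1)"
    using uv v by (auto simp: vert_contracts_iff clique_edges_iff)
  then show "{x, y} \<in> ST_edges n"
    unfolding ST_edges_def
    using uv label_in_ST_verts[OF v] label_in_ST_verts[OF uv(1)] label_clique_neq[OF uv(2,1)] by blast
qed

lemma walk_imp_relpow_ST:
  "walk 0 k u v \<Longrightarrow> u \<in> words (Suc n) \<Longrightarrow> (label u, label v) \<in> adj_rel (ST_edges n) ^^ k"
proof (induction rule: walk.induct)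
  case (step m u v k x)
  then have v: "v \<in> words (Suc n)"
    using sedge_in_words by blast
  show ?case
  proof (cases "m = 0")
    case True
    then have "(label u, label v) \<in> adj_rel (ST_edges n)"
      using step.hyps(1) step.prems by (auto simp: adj_rel_def ST_edges_iff)
    from relpow_Suc_I2[OF this step.IH[OF v]] show ?thesis
      using True by (simp add: link_def)
  next
    case False
    then show ?thesis
      using step.IH[OF v] label_nonclique_eq[OF step.hyps(1)] by (simp add: link_def)
  qed
qed simp

lemma wdist_label_le:
  assumes "label u = label u'" "u \<in> words (Suc n)" "u' \<in> words (Suc n)" "x \<in> words (Suc n)"
  shows "wdist 0 u x \<le> wdist 0 u' x"
  using label_eq_imp[OF assms(2,3,1)]
proof (elim disjE exE conjE)
  fix m :: nat assume "m > 0" "sedge m u u'"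
  then show ?thesis
    using sedge_wdist[of m u u' x 0] assms(2,4) by (simp add: link_def length_words)
qed simp

lemma relpow_ST_imp_wdist_le:
  "(label u, label v) \<in> adj_rel (ST_edges n) ^^ k \<Longrightarrow> u \<in> words (Suc n) \<Longrightarrow> v \<in> words (Suc n) \<Longrightarrow>
    wdist 0 u v \<le> k"
proof (induction k arbitrary: u)
  case 0
  then show ?case
    using wdist_label_le[of u v n v] by simp
next
  case (Suc k)
  from relpow_Suc_D2[OF Suc.prems(1)] obtain y
    where y: "(label u, y) \<in> adj_rel (ST_edges n)" "(y, label v) \<in> adj_rel (ST_edges n) ^^ k"
    by blast
  \<comment> \<open>The lifted edge may start at the other word u' with the label of u. For c = 0
    the change between the two is free.\<close>
  then obtain u' w where w: "u' \<in> words (Suc n)" "sedge 0 u' w" "label u = label u'" "y = label w"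
    by (auto simp: adj_rel_def ST_edges_iff)
  have "wdist 0 u v \<le> wdist 0 u' v"
    by (rule wdist_label_le[OF w(3) Suc.prems(2) w(1) Suc.prems(3)])
  also have "\<dots> \<le> 1 + wdist 0 w v"
    using sedge_wdist[OF w(2), of v 0] w(1) Suc.prems(3) by (simp add: link_def length_words)
  also have "wdist 0 w v \<le> k"
    using Suc.IH[of w] y(2) w sedge_in_words[OF w(2,1)] Suc.prems(3) by simp
  finally show ?case
    by simp
qed

lemma gdist_ST:
  assumes "u \<in> words (Suc n)" "v \<in> words (Suc n)"
  shows "gdist (ST_edges n) (label u) (label v) = wdist 0 u v"
  by (rule gdist_eqI[OF walk_imp_relpow_ST[OF walk_wdist[OF assms] assms(1)]
        relpow_ST_imp_wdist_le[OF _ assms]])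

section \<open>From sums over words to sums over vertices\<close>

lemma sum_ST_verts:
  "(\<Sum>x\<in>ST_verts n. F x) = (\<Sum>i\<in>T. F (Prim i)) + (\<Sum>l\<in>{1..n}. \<Sum>w\<in>words l. F (Word w))"
proof -
  have "(\<Sum>x\<in>ST_verts n. F x) = (\<Sum>x\<in>Prim ` T. F x) + (\<Sum>x\<in>(\<Union>l\<in>{1..n}. Word ` words l). F x)"
    unfolding ST_verts_def by (intro sum.union_disjoint) auto
  also have "(\<Sum>x\<in>(\<Union>l\<in>{1..n}. Word ` words l). F x) = (\<Sum>l\<in>{1..n}. \<Sum>x\<in>Word ` words l. F x)"
    by (intro sum.UNION_disjoint) (auto dest: length_words)
  finally show ?thesis
    by (simp add: sum.reindex inj_on_def)
qed

text \<open>F is arbitrary because the induction hypothesis is applied to F composed with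
  \<open>prefix_digit i\<close>.\<close>

lemma sum_label:
  fixes F :: "tvertex \<Rightarrow> nat"
  shows "(\<Sum>u\<in>words (Suc n). F (label u)) =
    (\<Sum>i\<in>T. F (Prim i)) + 2 * (\<Sum>l\<in>{1..n}. \<Sum>w\<in>words l. F (Word w))"
proof (induction n arbitrary: F)
  case 0
  then show ?case
    by (simp add: sum_words_Suc)
next
  case (Suc n)
  have "(\<Sum>u\<in>words (Suc (Suc n)). F (label u)) =
      (\<Sum>i\<in>T. \<Sum>u\<in>words (Suc n). F (prefix_digit i (label u)))"
    unfolding sum_words_Suc[of _ "Suc n"]
  proof (intro sum.cong)
    fix i t assume "t \<in> words (Suc n)"
    then have "t \<noteq> []"
      by (auto simp: words_def)
    then show "F (label (i # t)) = F (prefix_digit i (label t))"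
      by (simp add: label_Cons)
  qed auto
  also have "\<dots> = (\<Sum>i\<in>T. \<Sum>j\<in>T. F (prefix_digit i (Prim j))) +
      2 * (\<Sum>i\<in>T. \<Sum>l\<in>{1..n}. \<Sum>w\<in>words l. F (Word (i # w)))"
    unfolding Suc.IH[of "\<lambda>x. F (prefix_digit i x)" for i] by (simp add: sum.distrib sum_distrib_left)
  also have "(\<Sum>i\<in>T. \<Sum>l\<in>{1..n}. \<Sum>w\<in>words l. F (Word (i # w))) =
      (\<Sum>l\<in>{1..n}. \<Sum>w\<in>words (Suc l). F (Word w))"
    unfolding sum_words_Suc by (rule sum.swap)
  also have "\<dots> = (\<Sum>l\<in>{2..Suc n}. \<Sum>w\<in>words l. F (Word w))"
    using sum.shift_bounds_cl_Suc_ivl[of "\<lambda>l. \<Sum>w\<in>words l. F (Word w)" 1 n] by (simp add: numeral_2_eq_2)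
  \<comment> \<open>Pairs with i = j give the primitive vertices; (i, j) and (j, i) give the same
    one-digit word, hence the factor 2.\<close>
  also have "(\<Sum>i\<in>T. \<Sum>j\<in>T. F (prefix_digit i (Prim j))) =
      (\<Sum>i\<in>T. F (Prim i)) + 2 * (\<Sum>w\<in>words 1. F (Word w))"
    by (simp add: T_def sum_words_Suc)
  also have "(\<Sum>i\<in>T. F (Prim i)) + 2 * (\<Sum>w\<in>words 1. F (Word w)) +
      2 * (\<Sum>l\<in>{2..Suc n}. \<Sum>w\<in>words l. F (Word w)) =
      (\<Sum>i\<in>T. F (Prim i)) + 2 * (\<Sum>l\<in>{1..Suc n}. \<Sum>w\<in>words l. F (Word w))"
    using sum.atLeast_Suc_atMost[of 1 "Suc n" "\<lambda>l. \<Sum>w\<in>words l. F (Word w)"]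
    by (simp add: numeral_2_eq_2 del: sum.cl_ivl_Suc)
  finally show ?case .
qed

text \<open>Every vertex but the primitive ones is the contraction of two words, and the distances
  to the three primitive vertices have the same sum for all vertices.\<close>

lemma total_dist_ST:
  assumes "u \<in> words (Suc n)"
  shows "2 * total_dist (ST_verts n) (ST_edges n) (label u) = total_wdist 0 u + 2 * diam 0 (Suc n)"
proof -
  let ?F = "gdist (ST_edges n) (label u)"
  have "?F (Prim i) = corner_dist 0 i u" if "i \<in> T" for i
    using gdist_ST[OF assms, of "replicate (Suc n) i"] wdist_replicate[OF assms that, of 0] that
    by (simp add: label_replicate del: replicate_Suc)
  then have "(\<Sum>i\<in>T. ?F (Prim i)) = (\<Sum>i\<in>T. corner_dist 0 i u)"
    by simp
  also have "\<dots> = 2 * diam 0 (Suc n)"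
    using corner_dist_sum[of 0 1 2 u "Suc n" 0] assms by (simp add: T_def)
  finally have "(\<Sum>i\<in>T. ?F (Prim i)) = 2 * diam 0 (Suc n)" .
  moreover have "total_wdist 0 u = (\<Sum>v\<in>words (Suc n). ?F (label v))"
    using assms by (simp add: total_wdist_def length_words gdist_ST)
  ultimately show ?thesis
    unfolding total_dist_def sum_ST_verts sum_label by simp
qed

lemma median_ST:
  "median (ST_verts (Suc m)) (ST_edges (Suc m)) =
    label ` {i # j # replicate m h | i j h. i \<in> T \<and> j \<in> T \<and> h \<in> T \<and> i \<noteq> j \<and> i \<noteq> h}"
    (is "?M = label ` ?A")
proof -
  let ?W = "words (Suc (Suc m))" and ?t = "total_dist (ST_verts (Suc m)) (ST_edges (Suc m))"
  have verts: "ST_verts (Suc m) = label ` ?W"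
    using label_in_ST_verts by (auto elim: ST_verts_label)
  have le: "?t (label u) \<le> ?t (label v) \<longleftrightarrow> total_wdist 0 u \<le> total_wdist 0 v"
    if "u \<in> ?W" "v \<in> ?W" for u v
    using total_dist_ST[OF that(1)] total_dist_ST[OF that(2)] by linarith
  have "?M = label ` {u \<in> ?W. \<forall>v\<in>?W. total_wdist 0 u \<le> total_wdist 0 v}"
    unfolding median_def using le unfolding verts by auto
  also have "{u \<in> ?W. \<forall>v\<in>?W. total_wdist 0 u \<le> total_wdist 0 v} =
      {u \<in> ?W. \<exists>i\<in>T. \<exists>j\<in>T. \<exists>h\<in>T. i \<noteq> j \<and> i \<noteq> h \<and> u = i # j # replicate m h}"
    using total_wdist_minimal[of _ m 0] by blast
  also have "\<dots> = ?A"
    by auto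
  finally show ?thesis .
qed

section \<open>The six median vertices and the contracted edges\<close>

lemma label_median_words:
  assumes "m > 0"
  shows "label ` {i # j # replicate m h | i j h. i \<in> T \<and> j \<in> T \<and> h \<in> T \<and> i \<noteq> j \<and> i \<noteq> h} =
    {Word [0], Word [1], Word [2], Word [0, 0], Word [1, 1], Word [2, 2]}" (is "label ` ?A = ?B")
proof -
  have ijj: "label (i # j # replicate m j) = Word [3 - i - j]" if "i \<noteq> j" for i j
    using label_append[of i j "Suc m" "[]"] that by simp
  \<comment> \<open>Here m > 0 matters: the last change of digit is then the one from j to h. As
    both differ from i, the third digit is i again, which yields the vertices 00, 11, 22.\<close>
  have ijh: "label (i # j # replicate m h) = Word [i, 3 - j - h]" if "j \<noteq> h" for i j h
    using label_append[of j h m "[i]"] that assms by simp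
  have "label ` ?A = (\<lambda>k. Word [k]) ` T \<union> (\<lambda>k. Word [k, k]) ` T"
  proof (intro equalityI subsetI)
    fix x assume "x \<in> label ` ?A"
    then obtain i j h where *: "i \<in> T" "j \<in> T" "h \<in> T" "i \<noteq> j" "i \<noteq> h" "x = label (i # j # replicate m h)"
      by auto
    show "x \<in> (\<lambda>k. Word [k]) ` T \<union> (\<lambda>k. Word [k, k]) ` T"
    proof (cases "j = h")
      case True
      then show ?thesis
        using * ijj[of i j] third_digit(1)[of i j] by auto
    next
      case False
      then show ?thesis
        using * ijh[of j h i] third_digit_unique(1)[of j h i] by auto
    qed
  next
    fix x assume "x \<in> (\<lambda>k. Word [k]) ` T \<union> (\<lambda>k. Word [k, k]) ` T"
    then obtain k where k: "k \<in> T" "x = Word [k] \<or> x = Word [k, k]"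
      by auto
    from k(1) obtain i j where ij: "i \<in> T" "j \<in> T" "k \<noteq> i" "k \<noteq> j" "i \<noteq> j"
      by (rule obtain_digits)
    have "3 - i - j = k"
      using third_digit_unique(1)[of i j k] ij k(1) by auto
    then have "x = label (i # j # replicate m j) \<or> x = label (k # i # replicate m j)"
      using k(2) ij ijj[of i j] ijh[of i j k] by auto
    moreover have "i # j # replicate m j \<in> ?A" "k # i # replicate m j \<in> ?A"
      using ij k(1) by blast+
    ultimately show "x \<in> label ` ?A"
      by blast
  qed
  also have "\<dots> = ?B"
    by (auto simp: T_def)
  finally show ?thesis .
qed

text \<open>A contains with each word the other end of its non-clique edge: i j^(m+1) is joined to j
  i^(m+1), and i j h^m to i h j^m for j different from h.\<close>

lemma median_edges:
  assumes "m > 0"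
    and "A = {i # j # replicate m h | i j h. i \<in> T \<and> j \<in> T \<and> h \<in> T \<and> i \<noteq> j \<and> i \<noteq> h}"
  shows "{x. \<exists>e\<in>nonclique_edges (Suc (Suc m)). e \<subseteq> A \<and> edge_contracts_to (Suc m) e x} = label ` A"
proof (intro equalityI subsetI)
  fix x assume "x \<in> {x. \<exists>e\<in>nonclique_edges (Suc (Suc m)). e \<subseteq> A \<and> edge_contracts_to (Suc m) e x}"
  then obtain s i j d where *: "i \<in> T" "j \<in> T" "i \<noteq> j" "1 < d" "S_edge s i j d \<subseteq> A" "x = Word (s @ [3 - i - j])"
    by (auto simp: edge_contracts_to_def)
  then have "s @ i # replicate (d - 1) j \<in> A" "x = label (s @ i # replicate (d - 1) j)"
    by (auto simp: S_edge_def label_append)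
  then show "x \<in> label ` A"
    by blast
next
  fix x assume "x \<in> label ` A"
  then obtain i j h where ijh: "i \<in> T" "j \<in> T" "h \<in> T" "i \<noteq> j" "i \<noteq> h" "x = label (i # j # replicate m h)"
    unfolding assms(2) by auto
  show "x \<in> {x. \<exists>e\<in>nonclique_edges (Suc (Suc m)). e \<subseteq> A \<and> edge_contracts_to (Suc m) e x}"
  proof (cases "j = h")
    case True
    let ?e = "S_edge [] i j (Suc (Suc m))"
    have "?e \<in> nonclique_edges (Suc (Suc m))"
      unfolding nonclique_edges_def using ijh by fastforce
    moreover have "edge_contracts_to (Suc m) ?e x"
      unfolding edge_contracts_to_def
      using ijh True label_append[of i j "Suc m" "[]"]
      by (intro exI[of _ "[]"] exI[of _ i] exI[of _ j] exI[of _ "Suc (Suc m)"]) auto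
    moreover have "?e \<subseteq> A"
      unfolding assms(2) S_edge_def using ijh by force
    ultimately show ?thesis
      by blast
  next
    case False
    let ?e = "S_edge [i] j h (Suc m)"
    have "?e \<in> nonclique_edges (Suc (Suc m))"
      unfolding nonclique_edges_def using ijh False assms(1) by fastforce
    moreover have "edge_contracts_to (Suc m) ?e x"
      unfolding edge_contracts_to_def
      using ijh False assms(1) label_append[of j h m "[i]"]
      by (intro exI[of _ "[i]"] exI[of _ j] exI[of _ h] exI[of _ "Suc m"]) auto
    moreover have "?e \<subseteq> A"
      unfolding assms(2) S_edge_def using ijh by force
    ultimately show ?thesis
      by blast
  qed
qed

theorem theorem2:
  fixes n :: nat
  assumes "n \<ge> 2"
  shows "median (ST_verts n) (ST_edges n) =
           {Word [0], Word [1], Word [2], Word [0, 0], Word [1, 1], Word [2, 2]} \<and>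
         card (median (ST_verts n) (ST_edges n)) = 6 \<and>
         median (ST_verts n) (ST_edges n) =
           {x. \<exists>e\<in>nonclique_edges (n + 1).
                 e \<subseteq> median (S_verts (n + 1)) (S_edges (n + 1)) \<and> edge_contracts_to n e x}"
proof -
  obtain m where n: "n = Suc m" and m: "m > 0"
    using assms by (cases n) auto
  show ?thesis
    using median_edges[OF m refl] median_ST[of m] label_median_words[OF m]
    unfolding n by (simp add: median_S)
qed

end
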